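(* Let $\mu$ be a probability measure on $[0,1]$ satisfying (i) $\mu(\omega(0)=0)=\mu(\omega(0)=1)=0$, (ii) $\mathbb{E}_\mu[\log\rho(0)]=0$, (iii) $\mathbb{E}_\mu[(\log\rho(0))^2]<\infty$, where $\rho(0)=(1-\omega(0))/\omega(0)$. Let $[g_n,d_n]$ be the internal DLA cluster at step $n$ generated by Sinai's walk in the environment $\omega$ (as described in the context), and let $P$ be the annealed law. Then for all $0\le a\le b\le 1$, \[ P\left(\frac{d_n}{n}\in(a,b)\right)\xrightarrow[n\to\infty]{}\int_a^b\frac{1}{\pi\sqrt{x(1-x)}}\,dx, \] i.e. $d_n/n$ converges in law under $P$ to the Arcsine law.
   Context: An environment is $\omega=(\omega(i))_{i\in\mathbb{Z}}\in\Omega:=[0,1]^{\mathbb{Z}}$; set $\rho(i)=(1-\omega(i))/\omega(i)$. The environment is random with law $\mathbb{P}=\mu^{\otimes\mathbb{Z}}$. For fixed $\omega$, $\tilde P_\omega$ is the law of the Markov chain $(X_n)_{n\ge0}$ on $\mathbb{Z}$ with $X_0=0$, $\tilde P_\omega(X_{n+1}=x+1\mid X_n=x)=\omega(x)$, $\tilde P_\omega(X_{n+1}=x-1\mid X_n=x)=1-\omega(x)$. Let $(X^j)_{j\in\mathbb{N}}$ be i.i.d. walks each of law $\tilde P_\omega$ (same environment for all), with joint law $P_\omega=\tilde P_\omega^{\otimes\mathbb{N}}$, and $P=\int_\Omega P_\omega\,d\mathbb{P}$ (annealed law). The cluster is defined by $\theta_0=0$, $A(0)=\{0\}$, and for $j>0$: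 $\theta_j=\inf\{n\ge0: X^j(n)\notin A(j-1)\}$, $A(j)=A(j-1)\cup\{X^j(\theta_j)\}$. Each $A(n)$ is an integer interval, written $[g_n,d_n]$.
   Formalization: The formal statement adds the non-degeneracy condition that ω(0) is not almost surely 1/2; for μ = δ_{1/2} (simple random walk) conditions (i)–(iii) hold but d_n/n → 1/2, so the arcsine limit fails. *)

theory Defs
  imports "HOL-Probability.Probability"
begin

text \<open>Annealed probability space: an environment \<open>\<omega> :: int \<Rightarrow> real\<close> with law
  \<open>\<mu>\<^sup>\<otimes>\<int>\<close>, together with an i.i.d. family of uniform [0,1] variables
  \<open>U (j,n)\<close> that drive the walks: walk \<open>j\<close> at time \<open>n\<close> at site \<open>x\<close> jumps to
  \<open>x+1\<close> iff \<open>U (j,n) < \<omega> x\<close> (probability \<open>\<omega> x\<close>), else to \<open>x-1\<close>.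
  Given \<open>\<omega>\<close>, the walks \<open>X^j\<close> are i.i.d. with law \<open>P~_\<omega>\<close>, so the joint law of
  \<open>(\<omega>, (X^j)_j)\<close> is exactly the annealed law \<open>P\<close>.\<close>

definition annealed_space :: "real measure \<Rightarrow> ((int \<Rightarrow> real) \<times> (nat \<times> nat \<Rightarrow> real)) measure" where
  "annealed_space mu =
     (\<Pi>\<^sub>M i\<in>(UNIV::int set). mu) \<Otimes>\<^sub>M
     (\<Pi>\<^sub>M k\<in>(UNIV::(nat\<times>nat) set). uniform_measure lborel {0..1::real})"

fun walk :: "(int \<Rightarrow> real) \<Rightarrow> (nat \<times> nat \<Rightarrow> real) \<Rightarrow> nat \<Rightarrow> nat \<Rightarrow> int" where
  "walk \<omega> U j 0 = 0"
| "walk \<omega> U j (Suc n) =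
     walk \<omega> U j n + (if U (j, n) < \<omega> (walk \<omega> U j n) then 1 else -1)"

text \<open>Internal DLA cluster: \<open>A(0) = {0}\<close>, \<open>A(j) = A(j-1) \<union> {X^j(\<theta>_j)}\<close> with
  \<open>\<theta>_j\<close> the first exit time of \<open>X^j\<close> from \<open>A(j-1)\<close>. (If \<open>\<theta>_j = \<infinity>\<close>, a null
  event, the cluster is left unchanged.)\<close>
fun cluster :: "(int \<Rightarrow> real) \<Rightarrow> (nat \<times> nat \<Rightarrow> real) \<Rightarrow> nat \<Rightarrow> int set" where
  "cluster \<omega> U 0 = {0}"
| "cluster \<omega> U (Suc j) =
     (let A = cluster \<omega> U j in
      if \<exists>n. walk \<omega> U (Suc j) n \<notin> A
      then insert (walk \<omega> U (Suc j) (LEAST n. walk \<omega> U (Suc j) n \<notin> A)) A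
      else A)"

definition dright :: "(int \<Rightarrow> real) \<Rightarrow> (nat \<times> nat \<Rightarrow> real) \<Rightarrow> nat \<Rightarrow> int" where
  "dright \<omega> U n = Max (cluster \<omega> U n)"

end

theory Submission
  imports Defs "HOL-Real_Asymp.Real_Asymp"
begin

text \<open>Let \<open>V\<close> be the potential of the environment, a random walk with centred i.i.d. increments
  \<open>log \<rho>\<close>, and let \<open>M\<^sub>+(k)\<close> and \<open>M\<^sub>-(k)\<close> be its maxima over \<open>[0, k]\<close> and \<open>[-k, 0]\<close>.
  Since \<open>exp V\<close> is the discrete derivative of a harmonic function of the walk, each particle reaches \<open>q - 1 - n\<close>
  before \<open>q\<close> with probability at most \<open>n exp (M\<^sub>+(q - 1) - M\<^sub>-(n + 1 - q))\<close>, and symmetrically.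
  A union bound over the first \<open>n\<close> particles shows that \<open>d\<^sub>n < q\<close> is, up to an error that vanishes
  because the difference of the maxima is of order \<open>\<surd>n\<close>, the event \<open>M\<^sub>+(q - 1) > M\<^sub>-(n + 1 - q)\<close>.
  The two maxima are independent and, for \<open>q \<sim> x n\<close>, converge after rescaling to
  \<open>\<surd>x |N\<^sub>1|\<close> and \<open>\<surd>(1 - x) |N\<^sub>2|\<close> with independent standard normal variables, and
  \<open>P(\<surd>x |N\<^sub>1| > \<surd>(1 - x) |N\<^sub>2|) = (2/\<pi>) arcsin \<surd>x\<close>.\<close>

section \<open>The maximum of a centred random walk\<close>

text \<open>Two features shape the statements: the windows \<open>q - 1\<close> and
  \<open>n + 1 - q\<close> vary with \<open>n\<close>, and the quenched bounds are informative only
  when the difference of the maxima exceeds a margin. So the limit laws are carried over to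
  thresholds that move with \<open>n\<close>; monotone distribution functions with a continuous
  limit allow this. The margin is \<open>n powr (-1/4)\<close> times
  \<open>\<sigma> * sqrt n\<close>: negligible on the scale \<open>sqrt n\<close>, yet large enough
  for its exponential to beat the factor \<open>n^2\<close> of the union bound. Only upper bounds
  for hitting probabilities occur: the event and its complement are treated alike, and their
  probabilities add up to one. The two maxima read disjoint sets of sites, so the characteristic
  function of their difference is a product, and marginal convergence is enough. The potential must
  fluctuate: for the point mass at 1/2 it vanishes, the walks are simple, and d_n/n tends to 1/2
  instead.\<close>

lemma tendsto_mono_moving_argument:
  fixes F :: "nat \<Rightarrow> real \<Rightarrow> real" and G :: "real \<Rightarrow> real"
  assumes mono: "\<And>n. mono (F n)"
    and lim: "\<And>s. (\<lambda>n. F n s) \<longlonglongrightarrow> G s"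
    and cont: "isCont G t" and tn: "u \<longlonglongrightarrow> t"
  shows "(\<lambda>n. F n (u n)) \<longlonglongrightarrow> G t"
proof (rule order_tendstoI)
  fix y assume "y < G t"
  then have "eventually (\<lambda>s. y < G s) (at t)"
    using cont by (auto simp: isCont_def intro: order_tendstoD)
  then obtain d where d: "d > 0" "\<And>s. s \<noteq> t \<Longrightarrow> dist s t < d \<Longrightarrow> y < G s"
    by (auto simp: eventually_at)
  \<comment> \<open>Monotonicity stands in for uniform convergence: the fixed point
    \<open>t - d/2\<close> is eventually below \<open>u n\<close>, and pointwise convergence there
    already gives the bound.\<close>
  have "y < G (t - d/2)" using d(1) by (intro d(2)) (auto simp: dist_real_def)
  then have "eventually (\<lambda>n. y < F n (t - d/2)) sequentially"
    using lim order_tendstoD(1) by blast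
  moreover have "eventually (\<lambda>n. t - d/2 < u n) sequentially"
    using tn d(1) by (intro order_tendstoD(1)[OF tn]) auto
  ultimately show "eventually (\<lambda>n. y < F n (u n)) sequentially"
    by eventually_elim (meson less_imp_le mono monoD order_less_le_trans)
next
  fix y assume "G t < y"
  then have "eventually (\<lambda>s. G s < y) (at t)"
    using cont by (auto simp: isCont_def intro: order_tendstoD)
  then obtain d where d: "d > 0" "\<And>s. s \<noteq> t \<Longrightarrow> dist s t < d \<Longrightarrow> G s < y"
    by (auto simp: eventually_at)
  have "G (t + d/2) < y" using d(1) by (intro d(2)) (auto simp: dist_real_def)
  then have "eventually (\<lambda>n. F n (t + d/2) < y) sequentially"
    using lim order_tendstoD(2) by blast
  moreover have "eventually (\<lambda>n. u n < t + d/2) sequentially"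
    using tn d(1) by (intro order_tendstoD(2)[OF tn]) auto
  ultimately show "eventually (\<lambda>n. F n (u n) < y) sequentially"
    by eventually_elim (meson less_imp_le mono monoD order_le_less_trans)
qed

lemma (in prob_space) cdf_distr:
  assumes "f \<in> borel_measurable M"
  shows "cdf (distr M borel f) t = prob {x \<in> space M. f x \<le> t}"
  using assms by (simp add: cdf_def measure_distr vimage_def Int_def conj_commute)

section \<open>The standard normal law and its absolute value\<close>

interpretation std_normal: real_distribution std_normal_distribution
  by (rule real_dist_normal_dist)

lemma std_normal_singleton: "emeasure std_normal_distribution {x} = 0"
proof -
  have "AE y in lborel. y \<in> {x} \<longrightarrow> ennreal (std_normal_density y) = 0"
    using AE_lborel_singleton[of x] by eventually_elim auto
  then have "{x} \<in> null_sets std_normal_distribution"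
    by (subst null_sets_density_iff) auto
  then show ?thesis by auto
qed

lemma isCont_cdf_std_normal: "isCont (cdf std_normal_distribution) t"
  by (simp add: std_normal.isCont_cdf measure_def std_normal_singleton)

text \<open>The characteristic function \<open>exp (- t^2 / 2)\<close> is even, and it determines
  the law.\<close>

lemma distr_uminus_std_normal: "distr std_normal_distribution borel uminus = std_normal_distribution"
proof (rule Levy_uniqueness)
  show "char (distr std_normal_distribution borel uminus) = char std_normal_distribution"
  proof
    fix t
    have "char (distr std_normal_distribution borel uminus) t = char std_normal_distribution (- t)"
      by (simp add: char_def integral_distr)
    then show "char (distr std_normal_distribution borel uminus) t = char std_normal_distribution t"
      by (simp add: char_std_normal_distribution)
  qed
qed (auto intro: std_normal.real_distribution_distr std_normal.real_distribution_axioms)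

lemma std_normal_upper_tail: "measure std_normal_distribution {t..} = cdf std_normal_distribution (- t)"
proof -
  have "cdf std_normal_distribution (- t) = cdf (distr std_normal_distribution borel uminus) (- t)"
    by (simp add: distr_uminus_std_normal)
  also have "\<dots> = measure std_normal_distribution {t..}"
    by (subst std_normal.cdf_distr) (auto intro!: arg_cong[where f="measure _"])
  finally show ?thesis by simp
qed

lemma cdf_std_normal_uminus: "cdf std_normal_distribution (- t) = 1 - cdf std_normal_distribution t"
proof -
  have "measure std_normal_distribution {t..} = measure std_normal_distribution {t<..}"
  proof (rule std_normal.finite_measure_eq_AE)
    have "{t} \<in> null_sets std_normal_distribution"
      using std_normal_singleton[of t] by (auto intro: null_setsI)
    then have "AE x in std_normal_distribution. x \<notin> {t}" by (rule AE_not_in)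
    then show "AE x in std_normal_distribution. (x \<in> {t..}) = (x \<in> {t<..})"
      by eventually_elim auto
  qed auto
  also have "{t<..} = space std_normal_distribution - {..t}" by auto
  also have "measure std_normal_distribution \<dots> = 1 - cdf std_normal_distribution t"
    by (subst std_normal.prob_compl) (auto simp: cdf_def)
  finally show ?thesis using std_normal_upper_tail by simp
qed

lemma cdf_std_normal_zero: "cdf std_normal_distribution 0 = 1/2"
  using cdf_std_normal_uminus[of 0] by simp

text \<open>The half-normal law, limit of the rescaled maximum of the potential.\<close>

definition abs_normal :: "real measure" where
  "abs_normal = distr std_normal_distribution borel abs"

lemma cdf_abs_normal:
  "cdf abs_normal t = (if t < 0 then 0 else 2 * cdf std_normal_distribution t - 1)"
proof (cases "t < 0")
  case True
  then have "{x::real. \<bar>x\<bar> \<le> t} = {}" by auto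
  with True show ?thesis
    by (simp add: abs_normal_def std_normal.cdf_distr)
next
  case False
  have "cdf abs_normal t = measure std_normal_distribution ({..t} - {..<-t})"
    unfolding abs_normal_def
    by (subst std_normal.cdf_distr) (auto intro!: arg_cong[where f="measure _"])
  also have "\<dots> = cdf std_normal_distribution t - measure std_normal_distribution {..<-t}"
    using False by (subst std_normal.finite_measure_Diff) (auto simp: cdf_def)
  also have "measure std_normal_distribution {..<-t} = cdf std_normal_distribution (- t)"
    unfolding cdf_def
  proof (rule std_normal.finite_measure_eq_AE)
    have "{-t} \<in> null_sets std_normal_distribution"
      using std_normal_singleton[of "-t"] by (auto intro: null_setsI)
    then have "AE x in std_normal_distribution. x \<notin> {-t}" by (rule AE_not_in)
    then show "AE x in std_normal_distribution. (x \<in> {..<-t}) = (x \<in> {..-t})"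
      by eventually_elim auto
  qed auto
  finally show ?thesis using False by (simp add: cdf_std_normal_uminus)
qed

lemma abs_normal_distribution: "real_distribution abs_normal"
  unfolding abs_normal_def by (intro std_normal.real_distribution_distr) simp

lemma isCont_cdf_abs_normal: "isCont (cdf abs_normal) t"
proof -
  interpret real_distribution abs_normal by (rule abs_normal_distribution)
  have "measure abs_normal {t} = measure std_normal_distribution (abs -` {t})"
    unfolding abs_normal_def by (subst measure_distr) auto
  also have "\<dots> \<le> measure std_normal_distribution {t, -t}"
    by (intro std_normal.finite_measure_mono) auto
  also have "\<dots> \<le> measure std_normal_distribution {t} + measure std_normal_distribution {-t}"
    using measure_Un_le[of "{t}" std_normal_distribution "{-t}"] by (simp add: insert_commute)
  also have "\<dots> = 0" by (simp add: measure_def std_normal_singleton)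
  finally show ?thesis by (simp add: isCont_cdf measure_le_0_iff)
qed

text \<open>Instantiated twice over the same environment, with the increments of the potential to
  the right and to the left of the origin. The common law \<open>\<mu>\<close> of the increments is
  a parameter because the central limit theorem refers to it.\<close>

locale centered_iid = prob_space M for M :: "'a measure" +
  fixes X :: "nat \<Rightarrow> 'a \<Rightarrow> real" and \<mu> :: "real measure" and \<sigma> :: real
  assumes X_indep: "indep_vars (\<lambda>i. borel) X UNIV"
    and X_mean_0: "\<And>n. expectation (X n) = 0"
    and \<sigma>_pos: "\<sigma> > 0"
    and X_square_integrable: "\<And>n. integrable M (\<lambda>x. (X n x)\<^sup>2)"
    and X_variance: "\<And>n. variance (X n) = \<sigma>\<^sup>2"
    and X_distrib: "\<And>n. distr M borel (X n) = \<mu>"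
begin

definition S :: "nat \<Rightarrow> 'a \<Rightarrow> real" where
  "S n x = (\<Sum>i<n. X i x)"

definition maxS :: "nat \<Rightarrow> 'a \<Rightarrow> real" where
  "maxS n x = Max ((\<lambda>i. S i x) ` {..n})"

lemma X_measurable [measurable]: "X n \<in> borel_measurable M"
  using X_indep unfolding indep_vars_def2 by simp

lemma S_measurable [measurable]: "S n \<in> borel_measurable M"
  unfolding S_def[abs_def] by measurable

lemma maxS_le_iff: "maxS n x \<le> c \<longleftrightarrow> (\<forall>i\<le>n. S i x \<le> c)"
  unfolding maxS_def by (subst Max_le_iff) auto

lemma maxS_nonneg: "0 \<le> maxS n x"
  using maxS_le_iff[of n x "maxS n x"] by (auto simp: S_def dest: spec[of _ 0])

lemma maxS_measurable [measurable]: "maxS n \<in> borel_measurable M"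
  unfolding maxS_def[abs_def] by (intro borel_measurable_Max) auto

text \<open>The varying factor \<open>u n\<close> serves the upper bound for the maximum, where the
  end point is taken at the later time \<open>n + m0\<close> while the level still refers to
  \<open>sqrt n\<close>.\<close>

lemma S_clt:
  assumes "u \<longlonglongrightarrow> t"
  shows "(\<lambda>n. prob {x \<in> space M. S n x > u n * (\<sigma> * sqrt n)}) \<longlonglongrightarrow> 1 - cdf std_normal_distribution t"
proof -
  define F where "F n = cdf (distr M borel (\<lambda>x. (\<Sum>i<n. X i x) / sqrt (n * \<sigma>\<^sup>2)))" for n :: nat
  have "weak_conv_m (\<lambda>n. distr M borel (\<lambda>x. (\<Sum>i<n. X i x) / sqrt (n * \<sigma>\<^sup>2))) std_normal_distribution"
    by (rule central_limit_theorem_zero_mean[where X = X and \<mu> = \<mu> and \<sigma> = \<sigma>])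
       (simp_all add: X_indep X_mean_0 \<sigma>_pos X_square_integrable X_variance[unfolded X_mean_0 diff_zero] X_distrib)
  then have "(\<lambda>n. F n s) \<longlonglongrightarrow> cdf std_normal_distribution s" for s
    by (auto simp: weak_conv_m_def weak_conv_def isCont_cdf_std_normal F_def)
  moreover have "mono (F n)" for n
  proof -
    interpret D: real_distribution "distr M borel (\<lambda>x. (\<Sum>i<n. X i x) / sqrt (n * \<sigma>\<^sup>2))"
      by (intro real_distribution_distr) simp
    show ?thesis unfolding F_def by (intro monoI D.cdf_nondecreasing)
  qed
  ultimately have "(\<lambda>n. F n (u n)) \<longlonglongrightarrow> cdf std_normal_distribution t"
    using tendsto_mono_moving_argument[of F "cdf std_normal_distribution" t u]
      isCont_cdf_std_normal assms by blast
  then have "(\<lambda>n. 1 - F n (u n)) \<longlonglongrightarrow> 1 - cdf std_normal_distribution t"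
    by (intro tendsto_diff tendsto_const)
  then show ?thesis
  proof (rule Lim_transform_eventually)
    show "eventually (\<lambda>n. 1 - F n (u n) = prob {x \<in> space M. S n x > u n * (\<sigma> * sqrt n)}) sequentially"
      using eventually_gt_at_top[of 0]
    proof eventually_elim
      case (elim n)
      have "sqrt (n * \<sigma>\<^sup>2) = \<sigma> * sqrt n" using \<sigma>_pos by (simp add: real_sqrt_mult)
      then have "F n (u n) = prob {x \<in> space M. S n x \<le> u n * (\<sigma> * sqrt n)}"
        using \<sigma>_pos elim unfolding F_def
        by (subst cdf_distr) (auto simp: S_def pos_divide_le_eq)
      also have "1 - \<dots> = prob (space M - {x \<in> space M. S n x \<le> u n * (\<sigma> * sqrt n)})"
        by (subst prob_compl) auto
      also have "space M - {x \<in> space M. S n x \<le> u n * (\<sigma> * sqrt n)} = {x \<in> space M. S n x > u n * (\<sigma> * sqrt n)}"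
        by auto
      finally show ?case .
    qed
  qed
qed

lemma S_pos_half: "(\<lambda>n. prob {x \<in> space M. S n x > 0}) \<longlonglongrightarrow> 1/2"
  using S_clt[of "\<lambda>_. 0" 0] by (simp add: cdf_std_normal_zero)

text \<open>Both laws have the characteristic function
  \<open>char \<mu> t ^ (n - k)\<close>.\<close>

lemma distr_S_shift:
  assumes "k \<le> n"
  shows "distr M borel (\<lambda>x. S n x - S k x) = distr M borel (S (n - k))"
proof -
  have eq: "S n x - S k x = (\<Sum>i\<in>{k..<n}. X i x)" for x
    using assms by (simp add: S_def atLeast0LessThan[symmetric] sum_diff_nat_ivl)
  have ch: "char (distr M borel (\<lambda>x. \<Sum>i\<in>A. X i x)) t = char \<mu> t ^ card A" for A t
    by (subst char_distr_sum) (auto intro: indep_vars_subset[OF X_indep] simp: X_distrib)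
  show ?thesis
    unfolding eq unfolding S_def[abs_def]
    by (rule Levy_uniqueness) (auto simp: ch fun_eq_iff)
qed

definition first_above :: "real \<Rightarrow> nat \<Rightarrow> 'a set" where
  "first_above c k = {x \<in> space M. S k x > c \<and> (\<forall>i<k. S i x \<le> c)}"

lemma first_above_measurable [measurable]: "first_above c k \<in> sets M"
  unfolding first_above_def by measurable

lemma disjoint_first_above: "disjoint_family (first_above c)"
  unfolding disjoint_family_on_def first_above_def
proof safe
  fix m n :: nat and x
  assume "m \<noteq> n" "S m x > c" "\<forall>i<m. S i x \<le> c" "S n x > c" "\<forall>i<n. S i x \<le> c"
  then show "x \<in> {}" by (metis linorder_neqE_nat not_le)
qed

lemma UN_first_above: "(\<Union>k\<le>n. first_above c k) = {x \<in> space M. maxS n x > c}"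
proof safe
  fix x assume x: "x \<in> space M" "c < maxS n x"
  then have "\<exists>i\<le>n. S i x > c" using maxS_le_iff[of n x c] by (auto simp: not_le)
  then have e: "\<exists>i. i \<le> n \<and> S i x > c" by auto
  define k where "k = (LEAST i. i \<le> n \<and> S i x > c)"
  have "k \<le> n" "S k x > c" using LeastI_ex[OF e] by (auto simp: k_def)
  moreover have "S i x \<le> c" if "i < k" for i
    using not_less_Least[of i "\<lambda>i. i \<le> n \<and> S i x > c"] that \<open>k \<le> n\<close> by (auto simp: k_def not_less)
  ultimately show "x \<in> (\<Union>k\<le>n. first_above c k)" using x by (auto simp: first_above_def)
next
  fix x k assume "x \<in> first_above c k" "k \<le> n"
  then show "c < maxS n x" using maxS_le_iff[of n x c] by (auto simp: first_above_def not_le)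
qed (auto simp: first_above_def)

lemma prob_maxS_gt: "prob {x \<in> space M. maxS n x > c} = (\<Sum>k\<le>n. prob (first_above c k))"
  using disjoint_first_above[of c]
  by (subst UN_first_above[symmetric], subst finite_measure_finite_Union)
     (auto intro: disjoint_family_on_mono)

text \<open>The Markov property at the first passage time: \<open>first_above c k\<close> depends on
  the increments before index \<open>k\<close> only, \<open>S n - S k\<close> on those from
  \<open>k\<close> on; stationarity then replaces the latter by \<open>S (n - k)\<close>.\<close>

lemma prob_first_above_increment:
  assumes "k \<le> n"
  shows "prob (first_above c k \<inter> {x \<in> space M. S n x - S k x > e})
       = prob (first_above c k) * prob {x \<in> space M. S (n - k) x > e}"
proof -
  let ?A = "{..<k}" and ?B = "{k..<n}"
  let ?f = "\<lambda>y :: nat \<Rightarrow> real. (\<Sum>l<k. y l) > c \<and> (\<forall>i<k. (\<Sum>l<i. y l) \<le> c)"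
  let ?g = "\<lambda>y :: nat \<Rightarrow> real. (\<Sum>l\<in>{k..<n}. y l) > e"
  let ?XA = "{y \<in> space (PiM ?A (\<lambda>_. borel)). ?f y}"
  let ?XB = "{y \<in> space (PiM ?B (\<lambda>_. borel)). ?g y}"
  have ind: "indep_var (PiM ?A (\<lambda>_. borel)) (\<lambda>x. restrict (\<lambda>i. X i x) ?A)
                       (PiM ?B (\<lambda>_. borel)) (\<lambda>x. restrict (\<lambda>i. X i x) ?B)"
    by (rule indep_var_restrict[OF X_indep]) auto
  have meas: "(\<lambda>y. \<Sum>l<i. y l :: real) \<in> borel_measurable (PiM ?A (\<lambda>_. borel))" if "i \<le> k" for i
    using that by (intro borel_measurable_sum[of "{..<i}" "\<lambda>l y. y l"] measurable_component_singleton) auto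
  have XA: "?XA \<in> sets (PiM ?A (\<lambda>_. borel))"
  proof -
    have "?XA = {y \<in> space (PiM ?A (\<lambda>_. borel)). (\<Sum>l<k. y l) > c} \<inter>
        {y \<in> space (PiM ?A (\<lambda>_. borel)). \<forall>i\<in>{..<k}. (\<Sum>l<i. y l) \<le> c}" by auto
    also have "\<dots> \<in> sets (PiM ?A (\<lambda>_. borel))"
      using meas by (intro sets.Int sets.sets_Collect_finite_All borel_measurable_le borel_measurable_less) auto
    finally show ?thesis .
  qed
  have XB: "?XB \<in> sets (PiM ?B (\<lambda>_. borel))"
    by (intro borel_measurable_less borel_measurable_sum measurable_component_singleton) auto
  have rS: "(\<Sum>l<i. restrict (\<lambda>i. X i x) ?A l) = S i x" if "i \<le> k" for i x
    using that by (auto simp: S_def intro!: sum.cong)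
  have rD: "(\<Sum>l\<in>{k..<n}. restrict (\<lambda>i. X i x) ?B l) = S n x - S k x" for x
    using assms by (simp add: S_def atLeast0LessThan[symmetric] sum_diff_nat_ivl)
  have a: "(\<lambda>x. restrict (\<lambda>i. X i x) ?A) -` ?XA \<inter> space M = first_above c k"
    unfolding first_above_def using rS by (auto simp: space_PiM PiE_def)
  have b: "(\<lambda>x. restrict (\<lambda>i. X i x) ?B) -` ?XB \<inter> space M = {x \<in> space M. S n x - S k x > e}"
    using rD by (auto simp: space_PiM PiE_def)
  have ab: "(\<lambda>x. (restrict (\<lambda>i. X i x) ?A, restrict (\<lambda>i. X i x) ?B)) -` (?XA \<times> ?XB) \<inter> space M =
      ((\<lambda>x. restrict (\<lambda>i. X i x) ?A) -` ?XA \<inter> space M) \<inter> ((\<lambda>x. restrict (\<lambda>i. X i x) ?B) -` ?XB \<inter> space M)"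
    by blast
  have "prob (first_above c k \<inter> {x \<in> space M. S n x - S k x > e})
      = prob (first_above c k) * prob {x \<in> space M. S n x - S k x > e}"
    using indep_varD[OF ind XA XB] unfolding ab a b .
  also have "prob {x \<in> space M. S n x - S k x > e} = measure (distr M borel (\<lambda>x. S n x - S k x)) {e<..}"
    by (subst measure_distr) (auto intro!: arg_cong[where f=prob])
  also have "\<dots> = prob {x \<in> space M. S (n - k) x > e}"
    unfolding distr_S_shift[OF assms]
    by (subst measure_distr) (auto intro!: arg_cong[where f=prob])
  finally show ?thesis .
qed

text \<open>After the first passage the walk still ends above \<open>c\<close> if its remaining
  increment is positive. The horizon is prolonged by \<open>m0\<close> so that at least
  \<open>m0\<close> steps remain after any passage time \<open>k \<le> n\<close>, and the bound
  \<open>p\<close> is available.\<close>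

lemma prob_maxS_upper:
  assumes "\<And>m. m \<ge> m0 \<Longrightarrow> p \<le> prob {x \<in> space M. S m x > 0}"
  shows "p * prob {x \<in> space M. maxS n x > c} \<le> prob {x \<in> space M. S (n + m0) x > c}"
proof -
  let ?I = "\<lambda>k. first_above c k \<inter> {x \<in> space M. S (n + m0) x - S k x > 0}"
  have "p * prob {x \<in> space M. maxS n x > c} = (\<Sum>k\<le>n. prob (first_above c k) * p)"
    unfolding prob_maxS_gt by (simp add: sum_distrib_left mult.commute)
  also have "\<dots> \<le> (\<Sum>k\<le>n. prob (first_above c k) * prob {x \<in> space M. S (n + m0 - k) x > 0})"
    by (intro sum_mono mult_left_mono assms) auto
  also have "\<dots> = (\<Sum>k\<le>n. prob (?I k))"
    by (intro sum.cong refl prob_first_above_increment[symmetric]) auto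
  also have "\<dots> = prob (\<Union>k\<le>n. ?I k)"
    using disjoint_first_above[of c]
    by (intro finite_measure_finite_Union[symmetric]) (auto simp: disjoint_family_on_def)
  also have "\<dots> \<le> prob {x \<in> space M. S (n + m0) x > c}"
    by (intro finite_measure_mono) (auto simp: first_above_def)
  finally show ?thesis .
qed

text \<open>If no step exceeds \<open>e\<close>, the first passage lands at most \<open>e\<close>
  above \<open>c\<close>, so an end point above \<open>c + 2 * e\<close> needs a further increment
  above \<open>e\<close>. The large steps are paid for by a union bound.\<close>

lemma prob_maxS_lower:
  assumes "\<And>m. m \<le> n \<Longrightarrow> prob {x \<in> space M. S m x > e} \<le> p" and "c \<ge> 0" "e \<ge> 0"
  shows "prob {x \<in> space M. S n x > c + 2 * e}
    \<le> real n * measure \<mu> {e<..} + p * prob {x \<in> space M. maxS n x > c}"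
proof -
  let ?I = "\<lambda>k. first_above c k \<inter> {x \<in> space M. S n x - S k x > e}"
  let ?J = "\<lambda>i. {x \<in> space M. X i x > e}"
  have sub: "{x \<in> space M. S n x > c + 2 * e} \<subseteq> (\<Union>i<n. ?J i) \<union> (\<Union>k\<le>n. ?I k)"
  proof
    fix x assume x: "x \<in> {x \<in> space M. S n x > c + 2 * e}"
    then have "S n x > c" using assms(3) by auto
    then have "maxS n x > c" using maxS_le_iff[of n x c] by (auto simp: not_le)
    with x obtain k where k: "k \<le> n" "x \<in> first_above c k" using UN_first_above[of c n] by auto
    \<comment> \<open>\<open>S 0 = 0 \<le> c\<close> rules out a passage at time 0, so there is a
      passage step \<open>X j\<close>.\<close>
    have "k \<noteq> 0" using k(2) assms(2) by (intro notI) (simp add: first_above_def S_def)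
    then obtain j where j: "k = Suc j" by (cases k) auto
    show "x \<in> (\<Union>i<n. ?J i) \<union> (\<Union>k\<le>n. ?I k)"
    proof (cases "X j x > e")
      case True then show ?thesis using x j k by auto
    next
      case False
      have "S k x = S j x + X j x" by (simp add: S_def j)
      moreover have "S j x \<le> c" using k j by (auto simp: first_above_def)
      ultimately have "S n x - S k x > e" using False x by auto
      then show ?thesis using k x by auto
    qed
  qed
  have J: "prob (?J i) = measure \<mu> {e<..}" for i
    by (subst X_distrib[symmetric, of i], subst measure_distr) (auto intro!: arg_cong[where f=prob])
  have "prob {x \<in> space M. S n x > c + 2 * e} \<le> prob ((\<Union>i<n. ?J i) \<union> (\<Union>k\<le>n. ?I k))"
    using sub by (intro finite_measure_mono) auto
  also have "\<dots> \<le> prob (\<Union>i<n. ?J i) + prob (\<Union>k\<le>n. ?I k)"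
    by (intro measure_Un_le) auto
  also have "\<dots> \<le> (\<Sum>i<n. prob (?J i)) + (\<Sum>k\<le>n. prob (?I k))"
    by (intro add_mono measure_UNION_le) auto
  also have "(\<Sum>k\<le>n. prob (?I k)) = (\<Sum>k\<le>n. prob (first_above c k) * prob {x \<in> space M. S (n - k) x > e})"
    by (intro sum.cong refl prob_first_above_increment) auto
  also have "(\<Sum>i<n. prob (?J i)) + \<dots> \<le> (\<Sum>i<n. prob (?J i)) + (\<Sum>k\<le>n. prob (first_above c k) * p)"
    by (intro add_left_mono sum_mono mult_left_mono assms) auto
  also have "(\<Sum>k\<le>n. prob (first_above c k) * p) = p * prob {x \<in> space M. maxS n x > c}"
    unfolding prob_maxS_gt by (simp add: sum_distrib_left mult.commute)
  also have "(\<Sum>i<n. prob (?J i)) = real n * measure \<mu> {e<..}"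
    unfolding J by simp
  finally show ?thesis .
qed

text \<open>Chebyshev's inequality restricted to the tail: the product is at most
  \<open>1 / e^2\<close> times the second moment over the event \<open>X 0 > e * sqrt n\<close>,
  which vanishes by dominated convergence. The unrestricted inequality would only give
  boundedness.\<close>

lemma tail_negligible:
  assumes "e > 0"
  shows "(\<lambda>n. real n * measure \<mu> {e * sqrt n<..}) \<longlonglongrightarrow> 0"
proof -
  let ?A = "\<lambda>n::nat. {x \<in> space M. X 0 x > e * sqrt n}"
  let ?f = "\<lambda>(n::nat) x. (X 0 x)\<^sup>2 * indicator (?A n) x"
  have lim: "(\<lambda>n. expectation (?f n)) \<longlonglongrightarrow> expectation (\<lambda>x. 0)"
  proof (rule integral_dominated_convergence[where w="\<lambda>x. (X 0 x)\<^sup>2"])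
    show "AE x in M. (\<lambda>n. ?f n x) \<longlonglongrightarrow> 0"
    proof (intro AE_I2)
      fix x
      have "filterlim (\<lambda>n. e * sqrt (real n)) at_top sequentially"
        using assms by (intro filterlim_tendsto_pos_mult_at_top[OF tendsto_const]
          filterlim_compose[OF sqrt_at_top] filterlim_real_sequentially) auto
      then have "eventually (\<lambda>n. X 0 x \<le> e * sqrt n) sequentially"
        unfolding filterlim_at_top by blast
      then have "eventually (\<lambda>n. ?f n x = 0) sequentially"
        by eventually_elim auto
      then show "(\<lambda>n. ?f n x) \<longlonglongrightarrow> 0" by (rule tendsto_eventually)
    qed
    show "AE x in M. norm (?f n x) \<le> (X 0 x)\<^sup>2" for n
      by (intro AE_I2) (auto simp: indicator_def)
  qed (auto intro: X_square_integrable)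
  have le: "real n * measure \<mu> {e * sqrt n<..} \<le> expectation (?f n) / e\<^sup>2" for n
  proof -
    have "measure \<mu> {e * sqrt n<..} = prob (?A n)"
      by (subst X_distrib[symmetric, of 0], subst measure_distr) (auto intro!: arg_cong[where f=prob])
    moreover have "expectation (\<lambda>x. e\<^sup>2 * n * indicator (?A n) x) \<le> expectation (?f n)"
    proof (rule integral_mono)
      show "integrable M (?f n)"
        by (rule Bochner_Integration.integrable_bound[OF X_square_integrable[of 0]])
           (auto simp: indicator_def)
      show "integrable M (\<lambda>x. e\<^sup>2 * n * indicator (?A n) x)"
        by (intro integrable_mult_right integrable_real_indicator) (auto simp: less_top[symmetric])
      fix x
      have "e\<^sup>2 * n \<le> (X 0 x)\<^sup>2" if "X 0 x > e * sqrt n"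
      proof -
        have "e\<^sup>2 * n = (e * sqrt n)\<^sup>2" by (simp add: power_mult_distrib)
        also have "\<dots> \<le> (X 0 x)\<^sup>2" using that assms by (intro power_mono) auto
        finally show ?thesis .
      qed
      then show "e\<^sup>2 * n * indicator (?A n) x \<le> ?f n x" by (auto simp: indicator_def)
    qed
    ultimately show ?thesis using assms by (simp add: field_simps)
  qed
  have lim': "(\<lambda>n. expectation (?f n) / e\<^sup>2) \<longlonglongrightarrow> 0 / e\<^sup>2"
    using lim assms by (intro tendsto_divide) auto
  show ?thesis
  proof (rule tendsto_sandwich)
    show "eventually (\<lambda>n. 0 \<le> real n * measure \<mu> {e * sqrt n<..}) sequentially" by simp
    show "eventually (\<lambda>n. real n * measure \<mu> {e * sqrt n<..} \<le> expectation (?f n) / e\<^sup>2) sequentially"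
      by (intro always_eventually allI le)
    show "(\<lambda>n. expectation (?f n) / e\<^sup>2) \<longlonglongrightarrow> 0" using lim' by simp
  qed simp
qed

text \<open>The bound is uniform in \<open>m \<le> n\<close>: large \<open>m\<close> are covered by
  the central limit theorem at level 0, and each of the finitely many small \<open>m\<close> by the
  level tending to infinity.\<close>

lemma eventually_prob_S_gt_le:
  assumes "p > 1/2" "e > 0"
  shows "eventually (\<lambda>n. \<forall>m\<le>n. prob {x \<in> space M. S m x > e * sqrt n} \<le> p) sequentially"
proof -
  have "eventually (\<lambda>m. prob {x \<in> space M. S m x > 0} < p) sequentially"
    using S_pos_half assms(1) by (rule order_tendstoD)
  then obtain m0 where m0: "\<And>m. m \<ge> m0 \<Longrightarrow> prob {x \<in> space M. S m x > 0} < p"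
    by (auto simp: eventually_sequentially)
  have top: "filterlim (\<lambda>n. e * sqrt (real n)) at_top sequentially"
    using assms by (intro filterlim_tendsto_pos_mult_at_top[OF tendsto_const]
      filterlim_compose[OF sqrt_at_top] filterlim_real_sequentially) auto
  have "eventually (\<lambda>n. prob {x \<in> space M. S m x > e * sqrt n} \<le> p) sequentially" for m
  proof -
    interpret D: real_distribution "distr M borel (S m)" by simp
    have "(\<lambda>n. cdf (distr M borel (S m)) (e * sqrt n)) \<longlonglongrightarrow> 1"
      by (rule filterlim_compose[OF D.cdf_lim_at_top_prob top])
    then have "eventually (\<lambda>n. cdf (distr M borel (S m)) (e * sqrt n) > 1 - p) sequentially"
      using assms by (intro order_tendstoD(1)) auto
    then show ?thesis
    proof eventually_elim
      case (elim n)
      have "{x \<in> space M. S m x > e * sqrt n} = space M - {x \<in> space M. S m x \<le> e * sqrt n}"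
        by auto
      then have "prob {x \<in> space M. S m x > e * sqrt n} = 1 - cdf (distr M borel (S m)) (e * sqrt n)"
        by (simp add: prob_compl cdf_distr)
      with elim show ?case by simp
    qed
  qed
  then have "eventually (\<lambda>n. \<forall>m\<in>{..<m0}. prob {x \<in> space M. S m x > e * sqrt n} \<le> p) sequentially"
    by (intro eventually_ball_finite) auto
  then show ?thesis
  proof eventually_elim
    case (elim n)
    show ?case
    proof (intro allI impI)
      fix m assume "m \<le> n"
      show "prob {x \<in> space M. S m x > e * sqrt n} \<le> p"
      proof (cases "m < m0")
        case False
        have "prob {x \<in> space M. S m x > e * sqrt n} \<le> prob {x \<in> space M. S m x > 0}"
        proof (rule finite_measure_mono)
          have "0 \<le> e * sqrt n" using assms by simp
          then show "{x \<in> space M. S m x > e * sqrt n} \<subseteq> {x \<in> space M. S m x > 0}" by auto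
        qed simp
        then show ?thesis using m0[of m] False by simp
      qed (use elim in auto)
    qed
  qed
qed

text \<open>The limit law of the maximum without Donsker's theorem or symmetry of the steps: after the first passage
  above the level the increment is positive with probability close to one half, so the maximum exceeds
  the level about twice as often as the end point. The first passage overshoots by at most one step,
  which is negligible by the second moment.\<close>

theorem maxS_tail:
  assumes "t \<ge> 0"
  shows "(\<lambda>n. prob {x \<in> space M. maxS n x > t * (\<sigma> * sqrt n)})
      \<longlonglongrightarrow> 2 * (1 - cdf std_normal_distribution t)"
proof -
  define L where "L = 1 - cdf std_normal_distribution t"
  define g where "g n = prob {x \<in> space M. maxS n x > t * (\<sigma> * sqrt n)}" for n :: nat
  have L: "L \<ge> 0" unfolding L_def by (simp add: std_normal.cdf_bounded_prob)
  have "g \<longlonglongrightarrow> 2 * L"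
  proof (rule order_tendstoI)
    fix y assume y: "2 * L < y"
    \<comment> \<open>The midpoint of \<open>L / y\<close> and \<open>1/2\<close>; since
      \<open>2 * L < y\<close>, it lies strictly between them.\<close>
    define p where "p = 1/4 + L / (2 * y)"
    have "y > 0" using y L by simp
    have p: "p > 0" "p < 1/2" "L < y * p"
      using y L \<open>y > 0\<close> by (auto simp: p_def field_simps add_pos_nonneg)
    have "eventually (\<lambda>m. prob {x \<in> space M. S m x > 0} > p) sequentially"
      using S_pos_half p(2) by (rule order_tendstoD)
    then obtain m0 where m0: "\<And>m. m \<ge> m0 \<Longrightarrow> p \<le> prob {x \<in> space M. S m x > 0}"
      unfolding eventually_sequentially by (meson less_imp_le)
    \<comment> \<open>Chosen so that at time \<open>N = n + m0\<close> the level
      \<open>u N * (\<sigma> * sqrt N)\<close> is the original level for time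
      \<open>n\<close>.\<close>
    define u where "u N = t * (sqrt (real (N - m0)) / sqrt (real N))" for N :: nat
    have "(\<lambda>N. sqrt ((real N - real m0) / real N)) \<longlonglongrightarrow> sqrt 1"
      by (intro tendsto_real_sqrt) real_asymp
    then have "(\<lambda>N. t * sqrt ((real N - real m0) / real N)) \<longlonglongrightarrow> t * sqrt 1"
      by (intro tendsto_mult tendsto_const)
    then have "u \<longlonglongrightarrow> t * sqrt 1"
    proof (rule Lim_transform_eventually)
      show "eventually (\<lambda>N. t * sqrt ((real N - real m0) / real N) = u N) sequentially"
        using eventually_ge_at_top[of m0]
        by eventually_elim (auto simp: u_def real_sqrt_divide of_nat_diff)
    qed
    then have "u \<longlonglongrightarrow> t" by simp
    from S_clt[OF this] have "eventually (\<lambda>n. prob {x \<in> space M. S n x > u n * (\<sigma> * sqrt n)} < y * p) sequentially"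
      using p(3) unfolding L_def by (rule order_tendstoD)
    then have "eventually (\<lambda>n. prob {x \<in> space M. S (n + m0) x > u (n + m0) * (\<sigma> * sqrt (n + m0))} < y * p) sequentially"
      by (subst (asm) eventually_sequentially_seg[symmetric, of _ m0]) simp
    then show "eventually (\<lambda>n. g n < y) sequentially"
      using eventually_gt_at_top[of 0]
    proof eventually_elim
      case (elim n)
      have u_eq: "u (n + m0) * (\<sigma> * sqrt (n + m0)) = t * (\<sigma> * sqrt n)"
        using elim(2) by (simp add: u_def)
      have "p * g n \<le> prob {x \<in> space M. S (n + m0) x > t * (\<sigma> * sqrt n)}"
        unfolding g_def by (rule prob_maxS_upper[OF m0])
      also have "\<dots> < y * p" using elim(1) unfolding u_eq .
      finally have "p * g n < y * p" .
      then show ?case using p(1) by (simp add: mult.commute)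
    qed
  next
    fix y assume y: "y < 2 * L"
    \<comment> \<open>For positive \<open>y\<close> the witness is again the midpoint of
      \<open>1/2\<close> and \<open>L / y\<close>, the latter now being the larger one.\<close>
    have "\<exists>p>1/2. p * y < L"
    proof (cases "y > 0")
      case True
      show ?thesis
        using y L True by (intro exI[of _ "1/4 + L / (2 * y)"]) (auto simp: field_simps)
    next
      case False
      then show ?thesis using y L by (intro exI[of _ 1]) auto
    qed
    then obtain p where p: "p > 1/2" "p * y < L" by auto
    \<comment> \<open>By continuity the level may be raised to \<open>t + 2 * e\<close> for a small
      \<open>e\<close>: one \<open>e\<close> for the overshoot, one for the further
      increment.\<close>
    have "(\<lambda>n. 1 - cdf std_normal_distribution (t + 2 * (1 / real (Suc n)))) \<longlonglongrightarrow> 1 - cdf std_normal_distribution t"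
    proof (intro tendsto_diff tendsto_const)
      have "(\<lambda>n. t + 2 * (1 / real (Suc n))) \<longlonglongrightarrow> t" by real_asymp
      then show "(\<lambda>n. cdf std_normal_distribution (t + 2 * (1 / real (Suc n)))) \<longlonglongrightarrow> cdf std_normal_distribution t"
        by (rule isCont_tendsto_compose[OF isCont_cdf_std_normal])
    qed
    then have "eventually (\<lambda>n. 1 - cdf std_normal_distribution (t + 2 * (1 / real (Suc n))) > p * y) sequentially"
      using p(2) unfolding L_def by (rule order_tendstoD)
    then obtain k where k: "1 - cdf std_normal_distribution (t + 2 * (1 / real (Suc k))) > p * y"
      by (auto simp: eventually_sequentially)
    define e where "e = 1 / real (Suc k)"
    have e: "e > 0" by (simp add: e_def)
    define h where "h n = prob {x \<in> space M. S n x > (t + 2 * e) * (\<sigma> * sqrt n)}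
      - real n * measure \<mu> {(e * \<sigma>) * sqrt n<..}" for n :: nat
    have "h \<longlonglongrightarrow> (1 - cdf std_normal_distribution (t + 2 * e)) - 0"
      unfolding h_def using e \<sigma>_pos by (intro tendsto_diff S_clt tail_negligible tendsto_const) simp
    then have "eventually (\<lambda>n. h n > p * y) sequentially"
      using k by (intro order_tendstoD(1)) (auto simp: e_def)
    moreover have "eventually (\<lambda>n. \<forall>m\<le>n. prob {x \<in> space M. S m x > (e * \<sigma>) * sqrt n} \<le> p) sequentially"
      using e \<sigma>_pos p by (intro eventually_prob_S_gt_le) auto
    ultimately show "eventually (\<lambda>n. y < g n) sequentially"
    proof eventually_elim
      case (elim n)
      have "t * (\<sigma> * sqrt n) + 2 * ((e * \<sigma>) * sqrt n) = (t + 2 * e) * (\<sigma> * sqrt n)"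
        by (simp add: algebra_simps)
      then have "h n \<le> p * g n"
        using prob_maxS_lower[of n "(e * \<sigma>) * sqrt n" p "t * (\<sigma> * sqrt n)"] elim(2) assms e \<sigma>_pos
        by (simp add: h_def g_def)
      then have "p * y < p * g n" using elim(1) by simp
      then show ?case using p(1) by simp
    qed
  qed
  then show ?thesis by (simp add: g_def[abs_def] L_def)
qed

theorem maxS_weak_conv:
  assumes x: "x > 0" and m: "(\<lambda>n. real (m n) / real n) \<longlonglongrightarrow> x"
  shows "weak_conv_m (\<lambda>n. distr M borel (\<lambda>w. maxS (m n) w / (\<sigma> * sqrt n)))
    (distr abs_normal borel (\<lambda>y. sqrt x * y))"
  unfolding weak_conv_m_def weak_conv_def
proof (intro allI impI)
  fix s
  interpret A: real_distribution abs_normal by (rule abs_normal_distribution)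
  define F where "F k t = prob {w \<in> space M. maxS k w \<le> t * (\<sigma> * sqrt k)}" for k :: nat and t :: real
  have monoF: "mono (F k)" for k
    unfolding F_def
  proof (intro monoI finite_measure_mono subsetI)
    fix a b :: real and w assume "a \<le> b" "w \<in> {w \<in> space M. maxS k w \<le> a * (\<sigma> * sqrt k)}"
    moreover have "a * (\<sigma> * sqrt k) \<le> b * (\<sigma> * sqrt k)"
      using \<open>a \<le> b\<close> \<sigma>_pos by (intro mult_right_mono) auto
    ultimately show "w \<in> {w \<in> space M. maxS k w \<le> b * (\<sigma> * sqrt k)}" by auto
  qed auto
  have limF: "(\<lambda>k. F k t) \<longlonglongrightarrow> cdf abs_normal t" for t
  proof (cases "t < 0")
    case True
    have "eventually (\<lambda>k. F k t = 0) sequentially"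
      using eventually_gt_at_top[of 0]
    proof eventually_elim
      case (elim k)
      have "t * (\<sigma> * sqrt k) < 0" using True \<sigma>_pos elim by (simp add: mult_neg_pos)
      then have "{w \<in> space M. maxS k w \<le> t * (\<sigma> * sqrt k)} = {}"
        using maxS_nonneg[of k] by (auto simp: not_le intro: order_less_le_trans)
      then show ?case by (simp only: F_def measure_empty)
    qed
    then show ?thesis using True by (simp add: cdf_abs_normal tendsto_eventually)
  next
    case False
    have "(\<lambda>k. 1 - prob {w \<in> space M. maxS k w > t * (\<sigma> * sqrt k)}) \<longlonglongrightarrow> 1 - 2 * (1 - cdf std_normal_distribution t)"
      using False by (intro tendsto_diff tendsto_const maxS_tail) auto
    also have "(\<lambda>k. 1 - prob {w \<in> space M. maxS k w > t * (\<sigma> * sqrt (real k))}) = (\<lambda>k. F k t)"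
    proof
      fix k :: nat
      have "{w \<in> space M. maxS k w \<le> t * (\<sigma> * sqrt k)} = space M - {w \<in> space M. maxS k w > t * (\<sigma> * sqrt k)}"
        by auto
      then show "1 - prob {w \<in> space M. maxS k w > t * (\<sigma> * sqrt k)} = F k t"
        by (simp add: F_def prob_compl)
    qed
    finally show ?thesis using False by (simp add: cdf_abs_normal)
  qed
  \<comment> \<open>The level \<open>s * (\<sigma> * sqrt n)\<close> measured in the unit
    \<open>\<sigma> * sqrt (m n)\<close> that suits a walk of \<open>m n\<close> steps.\<close>
  define u where "u n = s * (1 / sqrt (real (m n) / real n))" for n
  have u: "u \<longlonglongrightarrow> s * (1 / sqrt x)"
    unfolding u_def using x by (intro tendsto_mult tendsto_divide tendsto_const tendsto_real_sqrt m) auto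
  have mtop: "filterlim m at_top sequentially"
  proof -
    have top: "filterlim (\<lambda>n. real (m n) / real n * real n) at_top sequentially"
      by (rule filterlim_tendsto_pos_mult_at_top[OF m x filterlim_real_sequentially])
    have ev: "eventually (\<lambda>n. real (m n) / real n * real n = real (m n)) sequentially"
      using eventually_gt_at_top[of 0] by eventually_elim auto
    have "filterlim (\<lambda>n. real (m n)) at_top sequentially"
      by (rule iffD1[OF filterlim_cong[OF refl refl ev] top])
    then show ?thesis
      by (simp add: filterlim_sequentially_iff_filterlim_real)
  qed
  have "(\<lambda>n. F (m n) (u n)) \<longlonglongrightarrow> cdf abs_normal (s * (1 / sqrt x))"
    using tendsto_mono_moving_argument[of "\<lambda>n. F (m n)" "cdf abs_normal" _ u, OF monoF
      filterlim_compose[OF limF mtop] isCont_cdf_abs_normal u] .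
  moreover have "eventually (\<lambda>n. F (m n) (u n) = cdf (distr M borel (\<lambda>w. maxS (m n) w / (\<sigma> * sqrt n))) s) sequentially"
    using eventually_gt_at_top[of 0] filterlim_at_top[THEN iffD1, OF mtop, rule_format, of 1]
  proof eventually_elim
    case (elim n)
    have "cdf (distr M borel (\<lambda>w. maxS (m n) w / (\<sigma> * sqrt n))) s
        = prob {w \<in> space M. maxS (m n) w / (\<sigma> * sqrt n) \<le> s}"
      by (rule cdf_distr) simp
    also have "\<dots> = prob {w \<in> space M. maxS (m n) w \<le> s * (\<sigma> * sqrt n)}"
      using elim \<sigma>_pos by (simp add: pos_divide_le_eq)
    also have "s * (\<sigma> * sqrt n) = u n * (\<sigma> * sqrt (m n))"
      using elim by (simp add: u_def real_sqrt_divide)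
    finally show ?case by (simp add: F_def)
  qed
  ultimately have "(\<lambda>n. cdf (distr M borel (\<lambda>w. maxS (m n) w / (\<sigma> * sqrt n))) s) \<longlonglongrightarrow> cdf abs_normal (s * (1 / sqrt x))"
    by (rule Lim_transform_eventually)
  moreover have "cdf (distr abs_normal borel (\<lambda>y. sqrt x * y)) s = cdf abs_normal (s * (1 / sqrt x))"
    using x by (subst A.cdf_distr) (auto simp: cdf_def field_simps intro!: arg_cong[where f="measure _"])
  ultimately show "(\<lambda>n. cdf (distr M borel (\<lambda>w. maxS (m n) w / (\<sigma> * sqrt n))) s)
      \<longlonglongrightarrow> cdf (distr abs_normal borel (\<lambda>y. sqrt x * y)) s"
    by simp
qed

end

section \<open>The Gaussian limit and the arcsine law\<close>

text \<open>As a function of \<open>v\<close> the product of the two densities is a multiple of the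
  centred normal density with variance \<open>r^2 = 1 / (1 + s^2)\<close>, so the integral is its
  first absolute moment up to a factor. The result is the Cauchy density, that of the quotient of
  two independent standard normal variables.\<close>

lemma nn_integral_std_normal_product:
  "(\<integral>\<^sup>+v. ennreal (std_normal_density v * \<bar>v\<bar> * std_normal_density (v * s)) \<partial>lborel)
    = ennreal (1 / (pi * (1 + s\<^sup>2)))"
proof -
  define r where "r = 1 / sqrt (1 + s\<^sup>2)"
  have pos: "1 + s\<^sup>2 > 0" by (simp add: add_pos_nonneg)
  have r: "r > 0" "r\<^sup>2 = 1 / (1 + s\<^sup>2)" using pos by (auto simp: r_def power_divide)
  have eq: "std_normal_density v * \<bar>v\<bar> * std_normal_density (v * s)
      = r / sqrt (2 * pi) * (normal_density 0 r v * \<bar>v - 0\<bar> ^ (2 * 0 + 1))" for v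
  proof -
    have "exp (- v\<^sup>2 / 2) * exp (- (v * s)\<^sup>2 / 2) = exp (- v\<^sup>2 / (2 * r\<^sup>2))"
      using pos by (simp add: exp_add[symmetric] r(2) power_mult_distrib field_simps)
    then show ?thesis using r(1)
      by (simp add: normal_density_def real_sqrt_mult field_simps)
  qed
  have "has_bochner_integral lborel (\<lambda>v. r / sqrt (2 * pi) * (normal_density 0 r v * \<bar>v - 0\<bar> ^ (2 * 0 + 1)))
      (r / sqrt (2 * pi) * (2 ^ 0 * r ^ (2 * 0 + 1) * fact 0 * sqrt (2 / pi)))"
    using normal_moment_abs_odd[of r 0 0] r(1) by (intro has_bochner_integral_mult_right) auto
  also have "(\<lambda>v. r / sqrt (2 * pi) * (normal_density 0 r v * \<bar>v - 0\<bar> ^ (2 * 0 + 1)))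
      = (\<lambda>v. std_normal_density v * \<bar>v\<bar> * std_normal_density (v * s))"
    using eq by auto
  also have "r / sqrt (2 * pi) * (2 ^ 0 * r ^ (2 * 0 + 1) * fact 0 * sqrt (2 / pi)) = r\<^sup>2 / pi"
    by (simp add: real_sqrt_mult real_sqrt_divide power2_eq_square)
  finally have "has_bochner_integral lborel (\<lambda>v. std_normal_density v * \<bar>v\<bar> * std_normal_density (v * s)) (r\<^sup>2 / pi)" .
  then show ?thesis
    by (subst nn_integral_eq_integral) (auto simp: has_bochner_integral_iff r(2))
qed

lemma nn_integral_arctan_density:
  assumes "c \<ge> 0"
  shows "(\<integral>\<^sup>+s. ennreal (1 / (pi * (1 + s\<^sup>2))) * indicator {-c..c} s \<partial>lborel) = ennreal (2 / pi * arctan c)"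
proof -
  have "(\<integral>\<^sup>+s. ennreal (1 / (pi * (1 + s\<^sup>2))) * indicator {-c..c} s \<partial>lborel)
      = ennreal (arctan c / pi - arctan (- c) / pi)"
  proof (rule nn_integral_FTC_Icc)
    fix s :: real
    have "1 + s\<^sup>2 \<noteq> 0" using zero_le_power2[of s] by linarith
    then show "((\<lambda>s. arctan s / pi) has_real_derivative 1 / (pi * (1 + s\<^sup>2))) (at s)"
      by (auto intro!: derivative_eq_intros simp: inverse_eq_divide)
  qed (use assms in \<open>auto simp: add_nonneg_nonneg\<close>)
  then show ?thesis by (simp add: arctan_minus)
qed

text \<open>The substitution \<open>u = v * s\<close> replaces polar coordinates in the computation of the Gaussian cone below.\<close>

lemma emeasure_std_normal_scaled:
  assumes "v \<noteq> 0"
  shows "emeasure std_normal_distribution {u. \<bar>u\<bar> \<le> c * \<bar>v\<bar>}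
    = (\<integral>\<^sup>+s. ennreal (\<bar>v\<bar> * std_normal_density (v * s)) * indicator {-c..c} s \<partial>lborel)"
proof -
  have "emeasure std_normal_distribution {u. \<bar>u\<bar> \<le> c * \<bar>v\<bar>}
      = (\<integral>\<^sup>+u. ennreal (std_normal_density u) * indicator {u. \<bar>u\<bar> \<le> c * \<bar>v\<bar>} u \<partial>lborel)"
    by (subst emeasure_density) auto
  also have "\<dots> = ennreal \<bar>v\<bar> * (\<integral>\<^sup>+s. ennreal (std_normal_density (0 + v * s)) * indicator {u. \<bar>u\<bar> \<le> c * \<bar>v\<bar>} (0 + v * s) \<partial>lborel)"
    using assms by (intro nn_integral_real_affine) auto
  also have "\<dots> = (\<integral>\<^sup>+s. ennreal \<bar>v\<bar> * (ennreal (std_normal_density (0 + v * s)) * indicator {u. \<bar>u\<bar> \<le> c * \<bar>v\<bar>} (0 + v * s)) \<partial>lborel)"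
    by (intro nn_integral_cmult[symmetric]) auto
  also have "\<dots> = (\<integral>\<^sup>+s. ennreal (\<bar>v\<bar> * std_normal_density (v * s)) * indicator {-c..c} s \<partial>lborel)"
  proof (intro nn_integral_cong)
    fix s
    have "\<bar>v * s\<bar> \<le> c * \<bar>v\<bar> \<longleftrightarrow> s \<in> {-c..c}"
      using assms by (auto simp: abs_mult abs_le_iff mult.commute[of "\<bar>v\<bar>"])
    then show "ennreal \<bar>v\<bar> * (ennreal (std_normal_density (0 + v * s)) * indicator {u. \<bar>u\<bar> \<le> c * \<bar>v\<bar>} (0 + v * s))
        = ennreal (\<bar>v\<bar> * std_normal_density (v * s)) * indicator {-c..c} s"
      by (simp add: ennreal_mult indicator_def mult.assoc)
  qed
  finally show ?thesis .
qed

interpretation normal_pair: pair_prob_space std_normal_distribution std_normal_distribution ..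

text \<open>Given the second coordinate \<open>v\<close>, the section becomes an integral over the
  quotient \<open>s\<close> in \<open>{-c..c}\<close>; exchanging the integrals leaves the Cauchy
  density, whose primitive is \<open>arctan s / pi\<close>.\<close>

lemma emeasure_normal_cone:
  assumes "c \<ge> 0"
  shows "emeasure (std_normal_distribution \<Otimes>\<^sub>M std_normal_distribution) {z. \<bar>fst z\<bar> \<le> c * \<bar>snd z\<bar>}
    = ennreal (2 / pi * arctan c)"
proof -
  let ?N = std_normal_distribution
  let ?A = "{z :: real \<times> real. \<bar>fst z\<bar> \<le> c * \<bar>snd z\<bar>}"
  have A: "?A \<in> sets (?N \<Otimes>\<^sub>M ?N)"
  proof -
    have "{z \<in> space (?N \<Otimes>\<^sub>M ?N). \<bar>fst z\<bar> \<le> c * \<bar>snd z\<bar>} \<in> sets (?N \<Otimes>\<^sub>M ?N)" by measurable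
    then show ?thesis by (simp add: space_pair_measure)
  qed
  have "emeasure (?N \<Otimes>\<^sub>M ?N) ?A = (\<integral>\<^sup>+v. emeasure ?N ((\<lambda>u. (u, v)) -` ?A) \<partial>?N)"
    by (rule normal_pair.emeasure_pair_measure_alt2[OF A])
  also have "\<dots> = (\<integral>\<^sup>+v. emeasure ?N {u. \<bar>u\<bar> \<le> c * \<bar>v\<bar>} \<partial>?N)"
    by (simp add: vimage_def)
  also have "\<dots> = (\<integral>\<^sup>+v. ennreal (std_normal_density v) * emeasure ?N {u. \<bar>u\<bar> \<le> c * \<bar>v\<bar>} \<partial>lborel)"
  proof (rule nn_integral_density)
    have "(\<lambda>v. emeasure ?N ((\<lambda>u. (u, v)) -` ?A)) \<in> borel_measurable ?N"
      by (rule normal_pair.measurable_emeasure_Pair2[OF A])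
    then show "(\<lambda>v. emeasure ?N {u. \<bar>u\<bar> \<le> c * \<bar>v\<bar>}) \<in> borel_measurable lborel"
      by (simp add: vimage_def)
  qed auto
  also have "\<dots> = (\<integral>\<^sup>+v. (\<integral>\<^sup>+s. ennreal (std_normal_density v * \<bar>v\<bar> * std_normal_density (v * s)) * indicator {-c..c} s \<partial>lborel) \<partial>lborel)"
  proof (rule nn_integral_cong_AE)
    \<comment> \<open>The substitution \<open>u = v * s\<close> degenerates at \<open>v = 0\<close>,
      hence equality only almost everywhere.\<close>
    show "AE v in lborel. ennreal (std_normal_density v) * emeasure ?N {u. \<bar>u\<bar> \<le> c * \<bar>v\<bar>}
        = (\<integral>\<^sup>+s. ennreal (std_normal_density v * \<bar>v\<bar> * std_normal_density (v * s)) * indicator {-c..c} s \<partial>lborel)"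
      using AE_lborel_singleton[of 0]
    proof eventually_elim
      case (elim v)
      show ?case
        by (subst emeasure_std_normal_scaled[OF elim], subst nn_integral_cmult[symmetric])
           (auto simp: ennreal_mult mult.assoc)
    qed
  qed
  also have "\<dots> = (\<integral>\<^sup>+s. (\<integral>\<^sup>+v. ennreal (std_normal_density v * \<bar>v\<bar> * std_normal_density (v * s)) * indicator {-c..c} s \<partial>lborel) \<partial>lborel)"
    by (rule lborel_pair.Fubini') simp
  also have "\<dots> = (\<integral>\<^sup>+s. ennreal (1 / (pi * (1 + s\<^sup>2))) * indicator {-c..c} s \<partial>lborel)"
    by (subst nn_integral_multc) (auto simp: nn_integral_std_normal_product)
  also have "\<dots> = ennreal (2 / pi * arctan c)"
    by (rule nn_integral_arctan_density[OF assms])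
  finally show ?thesis .
qed

section \<open>Differences of independent variables and their limit law\<close>

definition diff_distr :: "real measure \<Rightarrow> real measure \<Rightarrow> real measure" where
  "diff_distr A B = distr (A \<Otimes>\<^sub>M B) borel (\<lambda>z. fst z - snd z)"

lemma (in prob_space) char_distr_diff:
  fixes X1 X2 :: "'a \<Rightarrow> real"
  assumes "indep_var borel X1 borel X2"
  shows "char (distr M borel (\<lambda>\<omega>. X1 \<omega> - X2 \<omega>)) t =
    char (distr M borel X1) t * char (distr M borel X2) (- t)"
proof -
  have [measurable]: "X2 \<in> borel_measurable M" using assms by (rule indep_var_rv2)
  have "indep_var borel ((\<lambda>x. x) \<circ> X1) borel (uminus \<circ> X2)"
    by (rule indep_var_compose[OF assms]) auto
  then have "indep_var borel X1 borel (\<lambda>\<omega>. - X2 \<omega>)" by (simp add: comp_def)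
  from char_distr_add[OF this, of t] show ?thesis
    by (simp add: char_def integral_distr)
qed

lemma
  assumes "real_distribution A" "real_distribution B"
  shows diff_distr_distribution: "real_distribution (diff_distr A B)"
    and char_diff_distr: "char (diff_distr A B) t = char A t * char B (- t)"
proof -
  interpret A: real_distribution A by fact
  interpret B: real_distribution B by fact
  interpret P: pair_prob_space A B ..
  show "real_distribution (diff_distr A B)"
    unfolding diff_distr_def by (intro P.real_distribution_distr) simp
  have fst: "distr (A \<Otimes>\<^sub>M B) borel fst = A"
    using B.distr_pair_fst[of A] by (simp cong: distr_cong)
  have snd: "distr (A \<Otimes>\<^sub>M B) borel snd = B"
  proof (rule measure_eqI)
    fix S assume S: "S \<in> sets (distr (A \<Otimes>\<^sub>M B) borel snd)"
    have "snd -` S \<inter> space (A \<Otimes>\<^sub>M B) = space A \<times> S" by (auto simp: space_pair_measure)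
    then show "emeasure (distr (A \<Otimes>\<^sub>M B) borel snd) S = emeasure B S"
      using S A.emeasure_space_1
      by (simp add: emeasure_distr B.emeasure_pair_measure_Times)
  qed simp
  have "P.indep_var borel fst borel snd"
    unfolding P.indep_var_distribution_eq fst snd
  proof (intro conjI)
    show "A \<Otimes>\<^sub>M B = distr (A \<Otimes>\<^sub>M B) (borel \<Otimes>\<^sub>M borel) (\<lambda>x. (fst x, snd x))"
      by (simp, rule distr_id2[symmetric]) (intro sets_pair_measure_cong, auto)
  qed auto
  from P.char_distr_diff[OF this, of t] show "char (diff_distr A B) t = char A t * char B (- t)"
    unfolding diff_distr_def fst snd .
qed

text \<open>Independence makes the characteristic function of the difference a product, so Levy's
  continuity theorem needs the convergence of the marginals only.\<close>

lemma (in prob_space) weak_conv_diff: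
  fixes X Y :: "nat \<Rightarrow> 'a \<Rightarrow> real"
  assumes ind: "\<And>n. indep_var borel (X n) borel (Y n)"
    and A: "real_distribution A" "weak_conv_m (\<lambda>n. distr M borel (X n)) A"
    and B: "real_distribution B" "weak_conv_m (\<lambda>n. distr M borel (Y n)) B"
  shows "weak_conv_m (\<lambda>n. distr M borel (\<lambda>\<omega>. X n \<omega> - Y n \<omega>)) (diff_distr A B)"
proof (rule levy_continuity)
  have [measurable]: "X n \<in> borel_measurable M" "Y n \<in> borel_measurable M" for n
    using ind[of n] by (auto dest: indep_var_rv1 indep_var_rv2)
  show "real_distribution (distr M borel (\<lambda>\<omega>. X n \<omega> - Y n \<omega>))" for n by simp
  show "real_distribution (diff_distr A B)" using A B by (intro diff_distr_distribution)
  fix t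
  have "(\<lambda>n. char (distr M borel (X n)) t * char (distr M borel (Y n)) (- t)) \<longlonglongrightarrow> char A t * char B (- t)"
    by (intro tendsto_mult levy_continuity1 A B) auto
  then show "(\<lambda>n. char (distr M borel (\<lambda>\<omega>. X n \<omega> - Y n \<omega>)) t) \<longlonglongrightarrow> char (diff_distr A B) t"
    using A B by (simp add: char_distr_diff[OF ind] char_diff_distr)
qed

text \<open>The limit law of the right maximum minus the left maximum, in units of
  \<open>\<sigma> * sqrt n\<close>, when the right window has length asymptotic to
  \<open>x * n\<close>.\<close>

definition limit_diff :: "real \<Rightarrow> real measure" where
  "limit_diff x = diff_distr (distr abs_normal borel (\<lambda>y. sqrt x * y)) (distr abs_normal borel (\<lambda>y. sqrt (1 - x) * y))"

lemma scaled_abs_normal_distribution: "real_distribution (distr abs_normal borel (\<lambda>y. c * y))"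
proof -
  interpret A: real_distribution abs_normal by (rule abs_normal_distribution)
  show ?thesis by (intro A.real_distribution_distr) simp
qed

lemma limit_diff_distribution: "real_distribution (limit_diff x)"
  unfolding limit_diff_def by (intro diff_distr_distribution scaled_abs_normal_distribution)

lemma limit_diff_eq:
  "limit_diff x = distr (std_normal_distribution \<Otimes>\<^sub>M std_normal_distribution) borel
     (\<lambda>z. sqrt x * \<bar>fst z\<bar> - sqrt (1 - x) * \<bar>snd z\<bar>)"
proof -
  have d: "distr abs_normal borel (\<lambda>y. c * y) = distr std_normal_distribution borel (\<lambda>u. c * \<bar>u\<bar>)" for c
    unfolding abs_normal_def by (subst distr_distr) (auto simp: comp_def)
  have sf: "sigma_finite_measure (distr std_normal_distribution borel (\<lambda>u. c * \<bar>u\<bar>))" for c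
    using scaled_abs_normal_distribution[of c] unfolding d
    by (auto simp: real_distribution_def prob_space_imp_sigma_finite)
  show ?thesis
    unfolding limit_diff_def diff_distr_def d
    by (subst pair_measure_distr[OF _ _ sf], simp, simp, subst distr_distr)
       (auto simp: comp_def case_prod_beta)
qed

text \<open>For each fixed second coordinate at most two values of the first give the difference
  \<open>s\<close>, so the law has no atoms. Weak convergence thereby becomes convergence of the
  distribution functions everywhere, in particular around 0.\<close>

lemma isCont_cdf_limit_diff:
  assumes "0 < x"
  shows "isCont (cdf (limit_diff x)) s"
proof -
  let ?N = std_normal_distribution
  let ?f = "\<lambda>z :: real \<times> real. sqrt x * \<bar>fst z\<bar> - sqrt (1 - x) * \<bar>snd z\<bar>"
  interpret D: real_distribution "limit_diff x" by (rule limit_diff_distribution)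
  have m: "?f \<in> borel_measurable (?N \<Otimes>\<^sub>M ?N)" by measurable
  have A: "?f -` {s} \<inter> space (?N \<Otimes>\<^sub>M ?N) \<in> sets (?N \<Otimes>\<^sub>M ?N)"
    by (rule measurable_sets[OF m]) simp
  have "emeasure (limit_diff x) {s} = emeasure (?N \<Otimes>\<^sub>M ?N) (?f -` {s} \<inter> space (?N \<Otimes>\<^sub>M ?N))"
    unfolding limit_diff_eq by (rule emeasure_distr[OF m]) simp
  also have "\<dots> = (\<integral>\<^sup>+v. emeasure ?N ((\<lambda>u. (u, v)) -` (?f -` {s} \<inter> space (?N \<Otimes>\<^sub>M ?N))) \<partial>?N)"
    by (rule normal_pair.emeasure_pair_measure_alt2[OF A])
  also have "\<dots> = (\<integral>\<^sup>+v. 0 \<partial>?N)"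
  proof (intro nn_integral_cong)
    fix v
    define w where "w = (s + sqrt (1 - x) * \<bar>v\<bar>) / sqrt x"
    have "emeasure ?N ((\<lambda>u. (u, v)) -` (?f -` {s} \<inter> space (?N \<Otimes>\<^sub>M ?N))) \<le> emeasure ?N ({w} \<union> {-w})"
    proof (intro emeasure_mono subsetI)
      fix u assume "u \<in> (\<lambda>u. (u, v)) -` (?f -` {s} \<inter> space (?N \<Otimes>\<^sub>M ?N))"
      then have "sqrt x * \<bar>u\<bar> = s + sqrt (1 - x) * \<bar>v\<bar>" by auto
      then have "\<bar>u\<bar> = w" using assms by (simp add: w_def field_simps)
      then show "u \<in> {w} \<union> {-w}" by auto
    qed simp
    also have "\<dots> \<le> emeasure ?N {w} + emeasure ?N {-w}"
      by (rule emeasure_subadditive) auto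
    also have "\<dots> = 0" by (simp add: std_normal_singleton)
    finally show "emeasure ?N ((\<lambda>u. (u, v)) -` (?f -` {s} \<inter> space (?N \<Otimes>\<^sub>M ?N))) = 0" by simp
  qed
  finally show ?thesis by (simp add: D.isCont_cdf measure_def)
qed

text \<open>The event is a cone of slope \<open>1 / r\<close>, and
  \<open>r = sqrt x / sqrt (1 - x)\<close> is the tangent of \<open>arcsin (sqrt x)\<close>.\<close>

lemma cdf_limit_diff_0:
  assumes "0 < x" "x < 1"
  shows "cdf (limit_diff x) 0 = 1 - 2 / pi * arcsin (sqrt x)"
proof -
  let ?N = std_normal_distribution
  let ?f = "\<lambda>z :: real \<times> real. sqrt x * \<bar>fst z\<bar> - sqrt (1 - x) * \<bar>snd z\<bar>"
  define r where "r = sqrt x / sqrt (1 - x)"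
  have r: "r > 0" using assms by (simp add: r_def)
  have "cdf (limit_diff x) 0 = measure (?N \<Otimes>\<^sub>M ?N) {z \<in> space (?N \<Otimes>\<^sub>M ?N). ?f z \<le> 0}"
    unfolding limit_diff_eq by (rule normal_pair.cdf_distr) simp
  also have "{z \<in> space (?N \<Otimes>\<^sub>M ?N). ?f z \<le> 0} = {z. \<bar>fst z\<bar> \<le> (1 / r) * \<bar>snd z\<bar>}"
    using assms by (auto simp: space_pair_measure r_def field_simps)
  also have "measure (?N \<Otimes>\<^sub>M ?N) \<dots> = 2 / pi * arctan (1 / r)"
    unfolding measure_def using r by (subst emeasure_normal_cone) (auto simp: zero_le_arctan_iff)
  also have "arctan (1 / r) = pi / 2 - arctan r"
    using arctan_inverse[of r] r by (simp add: sgn_real_def inverse_eq_divide)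
  also have "arctan r = arcsin (sqrt x)"
    using assms arcsin_arctan[of "sqrt x"] order_less_le_trans[of "-1" 0 "sqrt x"] by (simp add: r_def)
  finally show ?thesis by (simp add: field_simps)
qed

section \<open>The arcsine distribution function and its density\<close>

lemma tendsto_arcsine_cdf:
  fixes y :: real
  assumes "y \<in> {0..1}"
  shows "((\<lambda>x. 2 / pi * arcsin (sqrt x)) \<longlongrightarrow> 2 / pi * arcsin (sqrt y)) (at y within {0..1})"
proof -
  have "continuous_on {0..1} (\<lambda>x::real. 2 / pi * arcsin (sqrt x))"
  proof (intro continuous_intros ballI conjI)
    show "- 1 \<le> sqrt x" "sqrt x \<le> 1" if "x \<in> {0..1}" for x :: real
      using that order_trans[of "-1" 0 "sqrt x"] by auto
  qed
  then show ?thesis using assms unfolding continuous_on_def by blast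
qed

lemma arcsine_cdf_at_endpoints:
  "((\<lambda>x. 2 / pi * arcsin (sqrt x)) \<longlongrightarrow> 0) (at_right 0)"
  "((\<lambda>x. 2 / pi * arcsin (sqrt x)) \<longlongrightarrow> 1) (at_left 1)"
  using tendsto_arcsine_cdf[of 0] tendsto_arcsine_cdf[of 1]
  by (simp_all add: at_within_Icc_at_right at_within_Icc_at_left)

text \<open>The integrand is unbounded near 0 and 1, so the fundamental theorem is used in its
  improper form: a nonnegative integrand on the open interval and one-sided limits of the primitive
  at both ends.\<close>

lemma arcsine_integral:
  fixes a b :: real
  assumes "0 \<le> a" "a < b" "b \<le> 1"
  shows "(LBINT x=a..b. 1 / (pi * sqrt (x * (1 - x)))) = 2 / pi * arcsin (sqrt b) - 2 / pi * arcsin (sqrt a)"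
proof -
  let ?F = "\<lambda>x. 2 / pi * arcsin (sqrt x)"
  have d: "DERIV ?F x :> 1 / (pi * sqrt (x * (1 - x)))" if "a < x" "x < b" for x
  proof -
    have x: "0 < x" "x < 1" using that assms by auto
    have s: "-1 < sqrt x" "sqrt x < 1" using x order_less_le_trans[of "-1" 0 "sqrt x"] by auto
    have "DERIV ?F x :> 2 / pi * (inverse (sqrt (1 - (sqrt x)\<^sup>2)) * (inverse (sqrt x) / 2))"
      using x s by (intro DERIV_cmult DERIV_chain2[OF DERIV_arcsin] DERIV_real_sqrt) auto
    also have "2 / pi * (inverse (sqrt (1 - (sqrt x)\<^sup>2)) * (inverse (sqrt x) / 2)) = 1 / (pi * sqrt (x * (1 - x)))"
      using x unfolding real_sqrt_mult by (simp add: divide_simps)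
    finally show ?thesis .
  qed
  show ?thesis
  proof (rule interval_integral_FTC_nonneg(2))
    show "ereal a < ereal b" using assms by simp
    show "DERIV ?F x :> 1 / (pi * sqrt (x * (1 - x)))" if "ereal a < ereal x" "ereal x < ereal b" for x
      using d that by simp
    show "isCont (\<lambda>x. 1 / (pi * sqrt (x * (1 - x)))) x" if "ereal a < ereal x" "ereal x < ereal b" for x
      using that assms by (intro continuous_intros) auto
    show "AE x in lborel. ereal a < ereal x \<longrightarrow> ereal x < ereal b \<longrightarrow> 0 \<le> 1 / (pi * sqrt (x * (1 - x)))"
      using assms by (intro AE_I2) auto
    have "(?F \<longlongrightarrow> ?F a) (at a within {a..b})"
      using assms by (intro tendsto_within_subset[OF tendsto_arcsine_cdf[of a]]) auto
    then have "(?F \<longlongrightarrow> ?F a) (at_right a)"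
      using assms by (simp add: at_within_Icc_at_right)
    then show "((?F \<circ> real_of_ereal) \<longlongrightarrow> ?F a) (at_right (ereal a))"
      by (simp add: ereal_tendsto_simps)
    have "(?F \<longlongrightarrow> ?F b) (at b within {a..b})"
      using assms by (intro tendsto_within_subset[OF tendsto_arcsine_cdf[of b]]) auto
    then have "(?F \<longlongrightarrow> ?F b) (at_left b)"
      using assms by (simp add: at_within_Icc_at_left)
    then show "((?F \<circ> real_of_ereal) \<longlongrightarrow> ?F b) (at_left (ereal b))"
      by (simp add: ereal_tendsto_simps)
  qed
qed

section \<open>Cluster and stopped walks in a fixed environment\<close>

lemma walk_Suc_cases: "walk \<omega> U j (Suc m) = walk \<omega> U j m + 1 \<or> walk \<omega> U j (Suc m) = walk \<omega> U j m - 1"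
  by auto

lemma first_exit_neighbour:
  assumes "g \<le> 0" "0 \<le> d" and ex: "\<exists>m. walk \<omega> U j m \<notin> {g..d}"
  defines "e \<equiv> LEAST m. walk \<omega> U j m \<notin> {g..d}"
  shows "walk \<omega> U j e = g - 1 \<or> walk \<omega> U j e = d + 1"
proof -
  have e: "walk \<omega> U j e \<notin> {g..d}" unfolding e_def by (rule LeastI_ex[OF ex])
  then have "e \<noteq> 0" using assms(1,2) by (intro notI) simp
  then obtain m where m: "e = Suc m" by (cases e) auto
  have "walk \<omega> U j m \<in> {g..d}"
    using not_less_Least[of m "\<lambda>m. walk \<omega> U j m \<notin> {g..d}"] m by (auto simp: e_def)
  then show ?thesis using e walk_Suc_cases[of \<omega> U j m] unfolding m by auto
qed

lemma cluster_Suc_interval: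
  assumes "cluster \<omega> U n = {g..d}" "g \<le> 0" "0 \<le> d" "\<exists>m. walk \<omega> U (Suc n) m \<notin> {g..d}"
  shows "cluster \<omega> U (Suc n) = {g - 1..d} \<or> cluster \<omega> U (Suc n) = {g..d + 1}"
proof -
  define w where "w = walk \<omega> U (Suc n) (LEAST m. walk \<omega> U (Suc n) m \<notin> {g..d})"
  have c: "cluster \<omega> U (Suc n) = insert w {g..d}"
    using assms unfolding w_def by (simp add: Let_def)
  have "w = g - 1 \<or> w = d + 1"
    unfolding w_def by (rule first_exit_neighbour[OF assms(2-4)])
  moreover have "insert (g - 1) {g..d} = {g - 1..d}" "insert (d + 1) {g..d} = {g..d + 1}"
    using assms(2,3) by auto
  ultimately show ?thesis unfolding c by auto
qed

text \<open>Holds for every \<open>U\<close>: a walk that never exits leaves the interval unchanged.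
  The measurability of the cluster rests on this unconditional form.\<close>

lemma cluster_interval: "\<exists>g d. g \<le> 0 \<and> 0 \<le> d \<and> cluster \<omega> U n = {g..d}"
proof (induction n)
  case 0
  show ?case by (intro exI[of _ 0]) auto
next
  case (Suc n)
  then obtain g d where gd: "g \<le> 0" "0 \<le> d" "cluster \<omega> U n = {g..d}" by auto
  show ?case
  proof (cases "\<exists>m. walk \<omega> U (Suc n) m \<notin> {g..d}")
    case True
    have "g - 1 \<le> 0" "0 \<le> d + 1" using gd by auto
    then show ?thesis using cluster_Suc_interval[OF gd(3,1,2) True] gd(1,2) by blast
  next
    case False
    then have "cluster \<omega> U (Suc n) = {g..d}" using gd by simp
    then show ?thesis using gd by blast
  qed
qed

lemma dright_interval: "cluster \<omega> U n = {g..d} \<Longrightarrow> g \<le> d \<Longrightarrow> dright \<omega> U n = d"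
  by (simp add: dright_def) (intro Max_eqI, auto)

lemma cluster_mono: "m \<le> n \<Longrightarrow> cluster \<omega> U m \<subseteq> cluster \<omega> U n"
proof (induction n rule: dec_induct)
  case (step n)
  then show ?case by (auto simp: Let_def)
qed simp

text \<open>Each particle that exits adds exactly one point, so the right end determines the left
  end. Exit from every bounded interval holds only almost surely and is therefore an
  assumption.\<close>

lemma cluster_width:
  assumes exit: "\<And>j B. \<exists>m. \<not> (- B < walk \<omega> U j m \<and> walk \<omega> U j m < B)"
  shows "\<exists>g d. g \<le> 0 \<and> 0 \<le> d \<and> cluster \<omega> U n = {g..d} \<and> d - g = int n"
proof (induction n)
  case 0
  show ?case by (intro exI[of _ 0]) auto
next
  case (Suc n)
  then obtain g d where gd: "g \<le> 0" "0 \<le> d" "cluster \<omega> U n = {g..d}" "d - g = int n" by auto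
  \<comment> \<open>As \<open>g \<le> 0\<close> and \<open>0 \<le> d\<close>, the open symmetric
    interval of radius \<open>d - g + 1\<close> contains \<open>{g..d}\<close>.\<close>
  obtain m where "\<not> (- (d - g + 1) < walk \<omega> U (Suc n) m \<and> walk \<omega> U (Suc n) m < d - g + 1)"
    using exit by blast
  then have "\<exists>m. walk \<omega> U (Suc n) m \<notin> {g..d}" using gd by (intro exI[of _ m]) auto
  from cluster_Suc_interval[OF gd(3,1,2) this] show ?case
  proof
    assume "cluster \<omega> U (Suc n) = {g - 1..d}"
    then show ?thesis using gd by (intro exI[of _ "g - 1"] exI[of _ d]) auto
  next
    assume "cluster \<omega> U (Suc n) = {g..d + 1}"
    then show ?thesis using gd by (intro exI[of _ g] exI[of _ "d + 1"]) auto
  qed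
qed

text \<open>The witness is the particle that adds \<open>z\<close>: before its exit time it stays in
  the cluster built by its predecessors, which does not contain \<open>z\<close>. Particle
  \<open>Suc j\<close> is the one that leaves \<open>cluster \<omega> U j\<close>.\<close>

lemma cluster_member_hit:
  assumes "z \<in> cluster \<omega> U n" "z \<noteq> 0"
  shows "\<exists>j<n. z \<notin> cluster \<omega> U j \<and>
    (\<exists>m. walk \<omega> U (Suc j) m = z \<and> (\<forall>k<m. walk \<omega> U (Suc j) k \<in> cluster \<omega> U j))"
  using assms(1)
proof (induction n)
  case 0
  then show ?case using assms(2) by simp
next
  case (Suc n)
  show ?case
  proof (cases "z \<in> cluster \<omega> U n")
    case True
    then show ?thesis using Suc.IH less_SucI by blast
  next
    case False
    let ?e = "LEAST m. walk \<omega> U (Suc n) m \<notin> cluster \<omega> U n"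
    have "z = walk \<omega> U (Suc n) ?e"
      using False Suc.prems by (auto simp: Let_def split: if_splits)
    moreover have "\<forall>k<?e. walk \<omega> U (Suc n) k \<in> cluster \<omega> U n"
      using not_less_Least by blast
    ultimately show ?thesis using False by (intro exI[of _ n]) auto
  qed
qed

text \<open>Translates a property of the cluster into one of a single walk. When \<open>p\<close> is
  added, the interval \<open>cluster \<omega> U j\<close> contains 0 but not \<open>p\<close>, so it
  lies to the right of \<open>p\<close>; it lies to the left of \<open>q\<close> because clusters
  only grow.\<close>

lemma cluster_hit_left:
  assumes "p < 0" "p \<in> cluster \<omega> U n" "\<And>y. y \<in> cluster \<omega> U n \<Longrightarrow> y < q"
  shows "\<exists>j<n. \<exists>m. walk \<omega> U (Suc j) m = p \<and> (\<forall>k<m. p < walk \<omega> U (Suc j) k \<and> walk \<omega> U (Suc j) k < q)"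
proof -
  obtain j m where j: "j < n" "p \<notin> cluster \<omega> U j" "walk \<omega> U (Suc j) m = p"
      "\<And>k. k < m \<Longrightarrow> walk \<omega> U (Suc j) k \<in> cluster \<omega> U j"
    using cluster_member_hit[OF assms(2)] assms(1) by blast
  obtain g d where gd: "g \<le> 0" "0 \<le> d" "cluster \<omega> U j = {g..d}" using cluster_interval by blast
  have "p < g" using j(2) assms(1) gd by auto
  then have "p < walk \<omega> U (Suc j) k \<and> walk \<omega> U (Suc j) k < q" if "k < m" for k
    using j(4)[OF that] gd(3) assms(3) cluster_mono[of j n \<omega> U] j(1) by auto
  then show ?thesis using j by blast
qed

lemma cluster_hit_right:
  assumes "q > 0" "q \<in> cluster \<omega> U n" "\<And>y. y \<in> cluster \<omega> U n \<Longrightarrow> p < y"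
  shows "\<exists>j<n. \<exists>m. walk \<omega> U (Suc j) m = q \<and> (\<forall>k<m. p < walk \<omega> U (Suc j) k \<and> walk \<omega> U (Suc j) k < q)"
proof -
  obtain j m where j: "j < n" "q \<notin> cluster \<omega> U j" "walk \<omega> U (Suc j) m = q"
      "\<And>k. k < m \<Longrightarrow> walk \<omega> U (Suc j) k \<in> cluster \<omega> U j"
    using cluster_member_hit[OF assms(2)] assms(1) by blast
  obtain g d where gd: "g \<le> 0" "0 \<le> d" "cluster \<omega> U j = {g..d}" using cluster_interval by blast
  have "d < q" using j(2) assms(1) gd by auto
  then have "p < walk \<omega> U (Suc j) k \<and> walk \<omega> U (Suc j) k < q" if "k < m" for k
    using j(4)[OF that] gd(3) assms(3) cluster_mono[of j n \<omega> U] j(1) by auto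
  then show ?thesis using j by blast
qed

text \<open>The walk frozen on leaving the open interval from \<open>p\<close> to \<open>q\<close>:
  its range is finite, and the events of being at an end by time \<open>n\<close> increase with
  \<open>n\<close>. \<open>U\<close> comes last so that a partial application is a random
  variable.\<close>

fun stopped :: "(int \<Rightarrow> real) \<Rightarrow> int \<Rightarrow> int \<Rightarrow> nat \<Rightarrow> nat \<Rightarrow> (nat \<times> nat \<Rightarrow> real) \<Rightarrow> int" where
  "stopped \<omega> p q j 0 U = 0"
| "stopped \<omega> p q j (Suc n) U =
     (if p < stopped \<omega> p q j n U \<and> stopped \<omega> p q j n U < q
      then stopped \<omega> p q j n U + (if U (j, n) < \<omega> (stopped \<omega> p q j n U) then 1 else -1)
      else stopped \<omega> p q j n U)"

lemma stopped_eq_walk: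
  "(\<And>k. k < m \<Longrightarrow> p < walk \<omega> U j k \<and> walk \<omega> U j k < q) \<Longrightarrow> stopped \<omega> p q j m U = walk \<omega> U j m"
  by (induction m) auto

lemma stopped_range: "p \<le> 0 \<Longrightarrow> 0 \<le> q \<Longrightarrow> stopped \<omega> p q j n U \<in> {p..q}"
  by (induction n) auto

lemma stopped_absorbed:
  assumes "\<not> (p < z \<and> z < q)" "stopped \<omega> p q j n U = z" "n \<le> m"
  shows "stopped \<omega> p q j m U = z"
  using assms(3) by (induction m rule: dec_induct) (use assms in auto)

lemma stopped_restrict:
  assumes "(\<lambda>k. (j, k)) ` {..<n} \<subseteq> K"
  shows "stopped \<omega> p q j n (restrict U K) = stopped \<omega> p q j n U"
  using assms
proof (induction n)
  case (Suc n)
  have "stopped \<omega> p q j n (restrict U K) = stopped \<omega> p q j n U"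
    by (rule Suc.IH) (use Suc.prems in auto)
  moreover have "(j, n) \<in> K" using Suc.prems by auto
  ultimately show ?case by (simp only: stopped.simps restrict_apply' simp_thms)
qed simp

abbreviation unif :: "real measure" where
  "unif \<equiv> uniform_measure lborel {0..1}"

abbreviation unifs :: "(nat \<times> nat \<Rightarrow> real) measure" where
  "unifs \<equiv> PiM UNIV (\<lambda>_. unif)"

lemma prob_space_unif: "prob_space unif"
  by (rule prob_space_uniform_measure) auto

interpretation unifs: prob_space unifs
  by (rule prob_space_PiM) (rule prob_space_unif)

text \<open>The joint law of the coordinates is the product of their laws, which characterises
  independence. It serves the driving variables as well as the environment.\<close>

lemma indep_vars_PiM_coordinates:
  fixes M :: "'i \<Rightarrow> 'a measure"
  assumes "\<And>i. prob_space (M i)"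
  shows "prob_space.indep_vars (PiM UNIV M) M (\<lambda>i x. x i) UNIV"
proof -
  interpret prob_space "PiM UNIV M" by (rule prob_space_PiM) (rule assms)
  have "distr (PiM UNIV M) (PiM UNIV M) (\<lambda>x. \<lambda>i\<in>UNIV. x i) = PiM UNIV M"
    by (simp add: restrict_UNIV distr_id)
  also have "\<dots> = PiM UNIV (\<lambda>i. distr (PiM UNIV M) (M i) (\<lambda>x. x i))"
    by (intro PiM_cong refl distr_PiM_component[symmetric]) (auto intro: assms)
  finally show ?thesis by (subst indep_vars_iff_distr_eq_PiM) auto
qed

text \<open>\<open>K\<close> is general because measurability is needed both on the full product and
  on the finitely many variables already read. A step looks up \<open>\<omega>\<close> at a random
  site, so it is composed over the countably many positions.\<close>

lemma stopped_measurable: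
  assumes "(\<lambda>k. (j, k)) ` {..<n} \<subseteq> K"
  shows "stopped \<omega> p q j n \<in> measurable (PiM K (\<lambda>_. unif)) (count_space UNIV)"
  using assms
proof (induction n)
  case 0
  then show ?case by (simp add: stopped.simps(1)[abs_def])
next
  case (Suc n)
  have [measurable]: "(\<lambda>U. U (j, n)) \<in> borel_measurable (PiM K (\<lambda>_. unif))"
    using Suc.prems measurable_component_singleton[of "(j, n)" K "\<lambda>_. unif"] by (auto cong: measurable_cong_sets)
  have "(\<lambda>U. (\<lambda>y U. if p < y \<and> y < q then y + (if U (j, n) < \<omega> y then 1 else -1) else y)
      (stopped \<omega> p q j n U) U) \<in> measurable (PiM K (\<lambda>_. unif)) (count_space UNIV)"
    by (rule measurable_compose_countable[OF _ Suc.IH]) (use Suc.prems in \<open>auto simp: lessThan_Suc\<close>)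
  then show ?case by (simp add: fun_eq_iff)
qed

lemma stopped_measurable_unifs [measurable]: "stopped \<omega> p q j n \<in> measurable unifs (count_space UNIV)"
  by (rule stopped_measurable) simp

lemma prob_unifs_less:
  assumes "0 \<le> c" "c \<le> 1"
  shows "unifs.prob {U \<in> space unifs. U k < c} = c"
proof -
  have "measure unif {..<c} = measure (distr unifs unif (\<lambda>U. U k)) {..<c}"
    by (subst distr_PiM_component) (auto intro: prob_space_unif)
  also have "\<dots> = unifs.prob {U \<in> space unifs. U k < c}"
    by (subst measure_distr) (auto intro!: arg_cong[where f="measure _"] measurable_component_singleton)
  also have "measure unif {..<c} = c"
  proof -
    have "{0..1} \<inter> {..<c} = {0..<c}" using assms by auto
    then show ?thesis using assms
      by (subst measure_uniform_measure) auto
  qed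
  finally show ?thesis by simp
qed

definition occ :: "(int \<Rightarrow> real) \<Rightarrow> int \<Rightarrow> int \<Rightarrow> nat \<Rightarrow> nat \<Rightarrow> int \<Rightarrow> real" where
  "occ \<omega> p q j n y = unifs.prob {U \<in> space unifs. stopped \<omega> p q j n U = y}"

text \<open>The Markov property: the position at time \<open>n\<close> is a function of the
  \<open>U (j, k)\<close> with \<open>k < n\<close>, hence independent of
  \<open>U (j, n)\<close>.\<close>

lemma prob_stopped_and_less:
  assumes "0 \<le> c" "c \<le> 1"
  shows "unifs.prob {U \<in> space unifs. stopped \<omega> p q j n U = y \<and> U (j, n) < c} = occ \<omega> p q j n y * c"
proof -
  let ?A = "(\<lambda>k. (j, k)) ` {..<n}" and ?B = "{(j, n)}"
  let ?PA = "PiM ?A (\<lambda>_. unif)" and ?PB = "PiM ?B (\<lambda>_. unif)"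
  let ?XA = "{u \<in> space ?PA. stopped \<omega> p q j n u = y}" and ?XB = "{u \<in> space ?PB. u (j, n) < c}"
  have ind: "unifs.indep_var ?PA (\<lambda>U. restrict (\<lambda>i. U i) ?A) ?PB (\<lambda>U. restrict (\<lambda>i. U i) ?B)"
    by (rule unifs.indep_var_restrict[OF indep_vars_PiM_coordinates[OF prob_space_unif]]) auto
  have [measurable]: "stopped \<omega> p q j n \<in> measurable ?PA (count_space UNIV)"
    by (rule stopped_measurable) simp
  have XA: "?XA \<in> sets ?PA" by measurable
  have XB: "?XB \<in> sets ?PB"
    by measurable
  have a: "(\<lambda>U. restrict (\<lambda>i. U i) ?A) -` ?XA \<inter> space unifs = {U \<in> space unifs. stopped \<omega> p q j n U = y}"
    by (auto simp: stopped_restrict space_PiM PiE_def)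
  have b: "(\<lambda>U. restrict (\<lambda>i. U i) ?B) -` ?XB \<inter> space unifs = {U \<in> space unifs. U (j, n) < c}"
    by (auto simp: space_PiM PiE_def)
  have ab: "(\<lambda>U. (restrict (\<lambda>i. U i) ?A, restrict (\<lambda>i. U i) ?B)) -` (?XA \<times> ?XB) \<inter> space unifs =
      ((\<lambda>U. restrict (\<lambda>i. U i) ?A) -` ?XA \<inter> space unifs) \<inter> ((\<lambda>U. restrict (\<lambda>i. U i) ?B) -` ?XB \<inter> space unifs)"
    by blast
  have "{U \<in> space unifs. stopped \<omega> p q j n U = y} \<inter> {U \<in> space unifs. U (j, n) < c}
      = {U \<in> space unifs. stopped \<omega> p q j n U = y \<and> U (j, n) < c}" by auto
  then show ?thesis
    using unifs.indep_varD[OF ind XA XB] unfolding ab a b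
    by (simp add: occ_def prob_unifs_less[OF assms])
qed

lemma integral_stopped:
  assumes "p \<le> 0" "0 \<le> q"
  shows "unifs.expectation (\<lambda>U. f (stopped \<omega> p q j n U)) = (\<Sum>y\<in>{p..q}. occ \<omega> p q j n y * f y)"
proof -
  have "unifs.expectation (\<lambda>U. f (stopped \<omega> p q j n U))
      = unifs.expectation (\<lambda>U. \<Sum>y\<in>{p..q}. indicator {U \<in> space unifs. stopped \<omega> p q j n U = y} U * f y)"
  proof (rule Bochner_Integration.integral_cong)
    fix U assume U: "U \<in> space unifs"
    have "(\<Sum>y\<in>{p..q}. indicator {U \<in> space unifs. stopped \<omega> p q j n U = y} U * f y)
        = (\<Sum>y\<in>{p..q}. if y = stopped \<omega> p q j n U then f y else 0)"
      using U by (intro sum.cong) auto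
    also have "\<dots> = f (stopped \<omega> p q j n U)"
      using stopped_range[OF assms] by (subst sum.delta) auto
    finally show "f (stopped \<omega> p q j n U)
        = (\<Sum>y\<in>{p..q}. indicator {U \<in> space unifs. stopped \<omega> p q j n U = y} U * f y)" by simp
  qed simp
  also have "\<dots> = (\<Sum>y\<in>{p..q}. unifs.expectation (\<lambda>U. indicator {U \<in> space unifs. stopped \<omega> p q j n U = y} U * f y))"
    by (intro Bochner_Integration.integral_sum integrable_mult_left integrable_real_indicator)
       (auto simp: less_top[symmetric])
  also have "\<dots> = (\<Sum>y\<in>{p..q}. occ \<omega> p q j n y * f y)"
    by (simp add: occ_def)
  finally show ?thesis .
qed

text \<open>The transition operator of the stopped walk applied to \<open>f\<close>; the ends are
  absorbing, so functions harmonic inside are its fixed points.\<close>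

definition step_avg :: "(int \<Rightarrow> real) \<Rightarrow> int \<Rightarrow> int \<Rightarrow> (int \<Rightarrow> real) \<Rightarrow> int \<Rightarrow> real" where
  "step_avg \<omega> p q f y =
    (if p < y \<and> y < q then \<omega> y * f (y + 1) + (1 - \<omega> y) * f (y - 1) else f y)"

text \<open>The one-step evolution of the law in dual form: each position splits according to
  whether the next driving variable falls below \<open>\<omega> y\<close>.\<close>

lemma sum_occ_Suc:
  assumes pq: "p \<le> 0" "0 \<le> q" and \<omega>: "\<And>y. 0 \<le> \<omega> y \<and> \<omega> y \<le> 1"
  shows "(\<Sum>y\<in>{p..q}. occ \<omega> p q j (Suc n) y * f y) = (\<Sum>y\<in>{p..q}. occ \<omega> p q j n y * step_avg \<omega> p q f y)"
proof -
  let ?I = "\<lambda>y. {U \<in> space unifs. stopped \<omega> p q j n U = y \<and> U (j, n) < \<omega> y}"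
  let ?J = "\<lambda>y. {U \<in> space unifs. stopped \<omega> p q j n U = y \<and> \<not> U (j, n) < \<omega> y}"
  let ?R = "\<lambda>y. if p < y \<and> y < q then f (y + 1) else f y"
  let ?L = "\<lambda>y. if p < y \<and> y < q then f (y - 1) else f y"
  have [measurable]: "(\<lambda>U. U (j, n)) \<in> borel_measurable unifs"
    using measurable_component_singleton[of "(j, n)" UNIV "\<lambda>_. unif"] by (auto cong: measurable_cong_sets)
  have I: "?I y \<in> sets unifs" and J: "?J y \<in> sets unifs" for y by measurable
  have pI: "unifs.prob (?I y) = occ \<omega> p q j n y * \<omega> y" for y
    using \<omega> by (intro prob_stopped_and_less) auto
  have pJ: "unifs.prob (?J y) = occ \<omega> p q j n y * (1 - \<omega> y)" for y
  proof -
    have "?J y = {U \<in> space unifs. stopped \<omega> p q j n U = y} - ?I y" by auto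
    then have "unifs.prob (?J y) = occ \<omega> p q j n y - unifs.prob (?I y)"
      using I by (simp only: occ_def) (rule unifs.finite_measure_Diff, auto)
    then show ?thesis by (simp add: pI algebra_simps)
  qed
  have "(\<Sum>y\<in>{p..q}. occ \<omega> p q j (Suc n) y * f y) = unifs.expectation (\<lambda>U. f (stopped \<omega> p q j (Suc n) U))"
    by (rule integral_stopped[OF pq, symmetric])
  also have "\<dots> = unifs.expectation (\<lambda>U. \<Sum>y\<in>{p..q}. indicator (?I y) U * ?R y + indicator (?J y) U * ?L y)"
  proof (rule Bochner_Integration.integral_cong)
    fix U assume U: "U \<in> space unifs"
    define x where "x = stopped \<omega> p q j n U"
    have "(\<Sum>y\<in>{p..q}. indicator (?I y) U * ?R y + indicator (?J y) U * ?L y)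
        = (\<Sum>y\<in>{p..q}. if y = x then (if U (j, n) < \<omega> y then ?R y else ?L y) else 0)"
      using U by (intro sum.cong refl) (auto simp: x_def indicator_def)
    also have "\<dots> = (if U (j, n) < \<omega> x then ?R x else ?L x)"
      using stopped_range[OF pq] by (subst sum.delta) (auto simp: x_def)
    also have "\<dots> = f (stopped \<omega> p q j (Suc n) U)"
      by (simp add: x_def[symmetric])
    finally show "f (stopped \<omega> p q j (Suc n) U)
        = (\<Sum>y\<in>{p..q}. indicator (?I y) U * ?R y + indicator (?J y) U * ?L y)" by (rule sym)
  qed simp
  also have "\<dots> = (\<Sum>y\<in>{p..q}. unifs.expectation (\<lambda>U. indicator (?I y) U * ?R y + indicator (?J y) U * ?L y))"
    using I J by (intro Bochner_Integration.integral_sum Bochner_Integration.integrable_add integrable_mult_left integrable_real_indicator)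
       (auto simp: less_top[symmetric])
  also have "\<dots> = (\<Sum>y\<in>{p..q}. occ \<omega> p q j n y * step_avg \<omega> p q f y)"
  proof (rule sum.cong)
    fix y
    have "unifs.expectation (\<lambda>U. indicator (?I y) U * ?R y + indicator (?J y) U * ?L y)
        = unifs.expectation (\<lambda>U. indicator (?I y) U * ?R y) + unifs.expectation (\<lambda>U. indicator (?J y) U * ?L y)"
      using I J by (intro Bochner_Integration.integral_add integrable_mult_left integrable_real_indicator)
        (auto simp: less_top[symmetric])
    also have "unifs.expectation (\<lambda>U. indicator (?I y) U * ?R y) = unifs.prob (?I y) * ?R y"
      using I by simp
    also have "unifs.expectation (\<lambda>U. indicator (?J y) U * ?L y) = unifs.prob (?J y) * ?L y"
      using J by simp
    finally have E: "unifs.expectation (\<lambda>U. indicator (?I y) U * ?R y + indicator (?J y) U * ?L y)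
        = unifs.prob (?I y) * ?R y + unifs.prob (?J y) * ?L y" .
    show "unifs.expectation (\<lambda>U. indicator (?I y) U * ?R y + indicator (?J y) U * ?L y)
        = occ \<omega> p q j n y * step_avg \<omega> p q f y"
      unfolding E pI pJ step_avg_def by (simp add: algebra_simps)
  qed simp
  finally show ?thesis .
qed

lemma occ_nonneg: "0 \<le> occ \<omega> p q j n y"
  by (simp add: occ_def)

lemma sum_occ_0:
  assumes "p \<le> 0" "0 \<le> q"
  shows "(\<Sum>y\<in>{p..q}. occ \<omega> p q j 0 y * f y) = f 0"
  using integral_stopped[OF assms, of f \<omega> j 0] by (simp add: unifs.prob_space)

text \<open>The martingale argument at a fixed time: the expectation of a harmonic function of the
  stopped walk stays \<open>f 0\<close>, and by nonnegativity a single term is at most the whole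
  sum.\<close>

lemma occ_harmonic_le:
  assumes pq: "p \<le> 0" "0 \<le> q" and \<omega>: "\<And>y. 0 \<le> \<omega> y \<and> \<omega> y \<le> 1"
    and harm: "\<And>y. p < y \<Longrightarrow> y < q \<Longrightarrow> \<omega> y * f (y + 1) + (1 - \<omega> y) * f (y - 1) = f y"
    and nn: "\<And>y. y \<in> {p..q} \<Longrightarrow> f y \<ge> 0" and z: "z \<in> {p..q}"
  shows "occ \<omega> p q j n z * f z \<le> f 0"
proof -
  have "(\<Sum>y\<in>{p..q}. occ \<omega> p q j n y * f y) = f 0"
  proof (induction n)
    case 0
    show ?case by (rule sum_occ_0[OF pq])
  next
    case (Suc n)
    have "step_avg \<omega> p q f y = f y" for y using harm by (simp add: step_avg_def)
    then show ?case using Suc by (simp add: sum_occ_Suc[OF pq \<omega>])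
  qed
  moreover have "occ \<omega> p q j n z * f z \<le> (\<Sum>y\<in>{p..q}. occ \<omega> p q j n y * f y)"
    using z nn by (intro member_le_sum) (auto simp: occ_nonneg)
  ultimately show ?thesis by simp
qed

text \<open>An end point is absorbing, so the events increase in \<open>n\<close> and a bound
  uniform in time passes to their union.\<close>

lemma prob_reaches_le:
  assumes z: "\<not> (p < z \<and> z < q)" and le: "\<And>n. occ \<omega> p q j n z \<le> c"
  shows "unifs.prob {U \<in> space unifs. \<exists>n. stopped \<omega> p q j n U = z} \<le> c"
proof -
  let ?A = "\<lambda>n. {U \<in> space unifs. stopped \<omega> p q j n U = z}"
  have "(\<lambda>n. unifs.prob (?A n)) \<longlonglongrightarrow> unifs.prob (\<Union>n. ?A n)"
  proof (rule unifs.finite_Lim_measure_incseq)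
    show "incseq ?A" unfolding incseq_def using stopped_absorbed[OF z] by blast
  qed auto
  then have "unifs.prob (\<Union>n. ?A n) \<le> c"
    by (rule LIMSEQ_le_const2) (use le in \<open>auto simp: occ_def\<close>)
  also have "(\<Union>n. ?A n) = {U \<in> space unifs. \<exists>n. stopped \<omega> p q j n U = z}" by auto
  finally show ?thesis .
qed

text \<open>For large \<open>l\<close> the function \<open>l ^ (y - p)\<close> gains at least \<open>1\<close> in expectation at each step taken
  inside the interval, yet it is bounded there; so the walk cannot stay inside forever.\<close>

lemma AE_stopped_exits:
  assumes pq: "p \<le> 0" "0 \<le> q" and \<omega>: "\<And>y. 0 < \<omega> y \<and> \<omega> y < 1"
  shows "AE U in unifs. \<exists>n. \<not> (p < stopped \<omega> p q j n U \<and> stopped \<omega> p q j n U < q)"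
proof -
  \<comment> \<open>Every interior site must satisfy \<open>\<omega> y * l \<ge> 2\<close>; the sum
    dominates each single \<open>2 / \<omega> y\<close>, and the extra 1 keeps
    \<open>l \<ge> 1\<close>.\<close>
  define l where "l = 1 + (\<Sum>y\<in>{p<..<q}. 2 / \<omega> y)"
  define f where "f y = l ^ nat (y - p)" for y
  define r where "r = unifs.prob {U \<in> space unifs. \<forall>n. p < stopped \<omega> p q j n U \<and> stopped \<omega> p q j n U < q}"
  have \<omega>': "0 \<le> \<omega> y \<and> \<omega> y \<le> 1" for y using \<omega>[of y] by auto
  have l1: "l \<ge> 1" unfolding l_def using \<omega>' by (simp add: sum_nonneg)
  have l2: "\<omega> y * l \<ge> 2" if "p < y" "y < q" for y
  proof -
    have "2 / \<omega> y \<le> (\<Sum>y\<in>{p<..<q}. 2 / \<omega> y)"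
      using that \<omega>' by (intro member_le_sum) auto
    then have "2 / \<omega> y \<le> l" by (simp add: l_def)
    then show ?thesis using \<omega>[of y] by (simp add: field_simps)
  qed
  have step: "f y + 1 \<le> step_avg \<omega> p q f y" if "p < y" "y < q" for y
  proof -
    define k where "k = nat (y - p)"
    have k: "nat (y - p) = k" "nat (y + 1 - p) = Suc k" using that unfolding k_def by linarith+
    have "2 * l ^ k \<le> \<omega> y * l * l ^ k" using l2[OF that] l1 by (intro mult_right_mono) auto
    moreover have "l ^ k \<ge> 1" using l1 by simp
    moreover have "0 \<le> (1 - \<omega> y) * f (y - 1)" using \<omega>'[of y] l1 by (simp add: f_def)
    moreover have "step_avg \<omega> p q f y = \<omega> y * l * l ^ k + (1 - \<omega> y) * f (y - 1)"
      using that k by (simp add: step_avg_def f_def)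
    moreover have "f y = l ^ k" by (simp add: f_def k)
    ultimately show ?thesis by linarith
  qed
  \<comment> \<open>Being inside at time \<open>n\<close> is at least as likely as staying inside
    forever, so the expectation grows by at least \<open>r\<close> at each step.\<close>
  have interior: "r \<le> (\<Sum>y\<in>{p<..<q}. occ \<omega> p q j n y)" for n
  proof -
    have "r \<le> unifs.prob (\<Union>y\<in>{p<..<q}. {U \<in> space unifs. stopped \<omega> p q j n U = y})"
      unfolding r_def by (intro unifs.finite_measure_mono) auto
    also have "\<dots> \<le> (\<Sum>y\<in>{p<..<q}. occ \<omega> p q j n y)"
      unfolding occ_def by (intro measure_UNION_le) auto
    finally show ?thesis .
  qed
  have grow: "real n * r \<le> (\<Sum>y\<in>{p..q}. occ \<omega> p q j n y * f y)" for n
  proof (induction n)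
    case 0
    show ?case using l1 by (intro order_trans[OF _ sum_nonneg]) (auto simp: occ_nonneg f_def)
  next
    case (Suc n)
    have "real (Suc n) * r \<le> (\<Sum>y\<in>{p..q}. occ \<omega> p q j n y * f y) + (\<Sum>y\<in>{p<..<q}. occ \<omega> p q j n y)"
      using Suc interior[of n] by (simp add: algebra_simps)
    also have "(\<Sum>y\<in>{p<..<q}. occ \<omega> p q j n y) = (\<Sum>y\<in>{p..q}. if p < y \<and> y < q then occ \<omega> p q j n y else 0)"
      by (rule sum.mono_neutral_cong_left) auto
    also have "(\<Sum>y\<in>{p..q}. occ \<omega> p q j n y * f y) + \<dots>
        = (\<Sum>y\<in>{p..q}. occ \<omega> p q j n y * (f y + (if p < y \<and> y < q then 1 else 0)))"
      by (subst sum.distrib[symmetric]) (auto intro!: sum.cong simp: algebra_simps)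
    also have "\<dots> \<le> (\<Sum>y\<in>{p..q}. occ \<omega> p q j n y * step_avg \<omega> p q f y)"
      using step by (intro sum_mono mult_left_mono occ_nonneg) (auto simp: step_avg_def)
    also have "\<dots> = (\<Sum>y\<in>{p..q}. occ \<omega> p q j (Suc n) y * f y)"
      by (rule sum_occ_Suc[OF pq \<omega>', symmetric])
    finally show ?case .
  qed
  have bound: "(\<Sum>y\<in>{p..q}. occ \<omega> p q j n y * f y) \<le> (\<Sum>y\<in>{p..q}. f y)" for n
    using l1 by (intro sum_mono mult_left_le_one_le) (auto simp: occ_nonneg f_def occ_def unifs.prob_le_1)
  have "r \<le> 0"
  proof (rule ccontr)
    assume "\<not> r \<le> 0"
    then obtain n :: nat where "(\<Sum>y\<in>{p..q}. f y) < real n * r"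
      using reals_Archimedean3[of r] by auto
    then show False using grow[of n] bound[of n] by simp
  qed
  then have "r = 0" by (simp add: r_def measure_le_0_iff)
  then have "AE U in unifs. \<not> (\<forall>n. p < stopped \<omega> p q j n U \<and> stopped \<omega> p q j n U < q)"
    unfolding r_def by (subst (asm) unifs.prob_eq_0) (auto elim: eventually_mono)
  then show ?thesis by eventually_elim auto
qed

lemma AE_walk_exits:
  assumes \<omega>: "\<And>y. 0 < \<omega> y \<and> \<omega> y < 1"
  shows "AE U in unifs. \<forall>j B. \<exists>m. \<not> (- B < walk \<omega> U j m \<and> walk \<omega> U j m < B)"
proof -
  have "AE U in unifs. \<exists>m. \<not> (- B < walk \<omega> U j m \<and> walk \<omega> U j m < B)" for j B
  proof (cases "0 \<le> B")
    case True
    then have "AE U in unifs. \<exists>n. \<not> (- B < stopped \<omega> (- B) B j n U \<and> stopped \<omega> (- B) B j n U < B)"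
      using \<omega> by (intro AE_stopped_exits) auto
    then show ?thesis
    proof eventually_elim
      case (elim U)
      show ?case
      proof (rule ccontr)
        assume "\<nexists>m. \<not> (- B < walk \<omega> U j m \<and> walk \<omega> U j m < B)"
        then show False using elim stopped_eq_walk[of _ "-B" \<omega> U j B] by auto
      qed
    qed
  \<comment> \<open>For negative \<open>B\<close> no position satisfies both inequalities.\<close>
  qed auto
  then show ?thesis by (simp add: AE_all_countable)
qed

section \<open>Quenched estimates through the potential\<close>

definition log_ratio :: "real \<Rightarrow> real" where
  "log_ratio x = ln ((1 - x) / x)"

lemma log_ratio_measurable [measurable]: "log_ratio \<in> borel_measurable borel"
  unfolding log_ratio_def[abs_def] by measurable

text \<open>Normalised to 0 at the origin, with increment \<open>log_ratio (\<omega> y)\<close> from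
  \<open>y - 1\<close> to \<open>y\<close>. The right half thus reads the sites from 1 on and the
  left half those up to 0: disjoint sets, hence independent halves.\<close>

definition potential :: "(int \<Rightarrow> real) \<Rightarrow> int \<Rightarrow> real" where
  "potential \<omega> y = (if 0 \<le> y then \<Sum>i<nat y. log_ratio (\<omega> (int i + 1))
     else - (\<Sum>i<nat (- y). log_ratio (\<omega> (- int i))))"

lemma potential_nat: "potential \<omega> (int k) = (\<Sum>i<k. log_ratio (\<omega> (int i + 1)))"
  by (simp add: potential_def)

lemma potential_uminus_nat: "potential \<omega> (- int k) = (\<Sum>i<k. - log_ratio (\<omega> (- int i)))"
  by (cases "k = 0") (simp_all add: potential_def sum_negf)

lemma potential_step: "potential \<omega> y = potential \<omega> (y - 1) + log_ratio (\<omega> y)"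
proof (cases "y \<ge> 1")
  case True
  define k where "k = nat (y - 1)"
  have k: "y = int (Suc k)" "y - 1 = int k" using True by (auto simp: k_def)
  show ?thesis unfolding k(2) unfolding k(1) potential_nat by (simp add: add.commute)
next
  case False
  define k where "k = nat (- y)"
  have k: "y = - int k" "y - 1 = - int (Suc k)" using False by (auto simp: k_def)
  show ?thesis unfolding k(2) unfolding k(1) potential_uminus_nat by simp
qed

text \<open>Reversibility of the walk: \<open>exp (potential \<omega> y)\<close> is the resistance
  of the edge between \<open>y\<close> and \<open>y + 1\<close>.\<close>

lemma exp_potential_step:
  assumes "0 < \<omega> y" "\<omega> y < 1"
  shows "(1 - \<omega> y) * exp (potential \<omega> (y - 1)) = \<omega> y * exp (potential \<omega> y)"
  using assms unfolding potential_step[of \<omega> y] by (simp add: exp_add log_ratio_def)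

text \<open>By the step relation of the potential, sums of \<open>exp (potential \<omega> x)\<close> over intervals ending at a
  boundary point are harmonic for the walk.\<close>

lemma prob_reaches_left_le:
  assumes \<omega>: "\<And>y. 0 < \<omega> y \<and> \<omega> y < 1" and pq: "p < 0" "0 < q"
    and a: "\<And>x. x \<in> {0..<q} \<Longrightarrow> potential \<omega> x \<le> a" and b: "x0 \<in> {p..<q}" "b \<le> potential \<omega> x0"
  shows "unifs.prob {U \<in> space unifs. \<exists>n. stopped \<omega> p q j n U = p} \<le> real_of_int q * exp (a - b)"
proof (rule prob_reaches_le)
  fix n
  \<comment> \<open>The harmonic function that vanishes at \<open>q\<close>: \<open>h 0\<close> has
    \<open>q\<close> terms of size at most \<open>exp a\<close>, while \<open>h p\<close> contains
    the term at \<open>x0\<close>.\<close>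
  define h where "h y = (\<Sum>x\<in>{y..<q}. exp (potential \<omega> x))" for y
  have h_rec: "h y = exp (potential \<omega> y) + h (y + 1)" if "y < q" for y
  proof -
    have "{y..<q} = insert y {y + 1..<q}" using that by auto
    then show ?thesis unfolding h_def by simp
  qed
  have "occ \<omega> p q j n p * h p \<le> h 0"
  proof (rule occ_harmonic_le)
    fix y assume y: "p < y" "y < q"
    have "h y = exp (potential \<omega> y) + h (y + 1)" "h (y - 1) = exp (potential \<omega> (y - 1)) + h y"
      using h_rec[of y] h_rec[of "y - 1"] y by auto
    then show "\<omega> y * h (y + 1) + (1 - \<omega> y) * h (y - 1) = h y"
      using exp_potential_step[of \<omega> y] \<omega>[of y] by (simp add: algebra_simps)
  qed (use pq \<omega> in \<open>auto simp: h_def less_imp_le intro: sum_nonneg\<close>)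
  also have "h 0 \<le> (\<Sum>x\<in>{0..<q}. exp a)"
    unfolding h_def using a by (intro sum_mono) auto
  also have "\<dots> = real_of_int q * exp a" using pq by simp
  finally have 1: "occ \<omega> p q j n p * h p \<le> real_of_int q * exp a" .
  have "exp b \<le> exp (potential \<omega> x0)" using b by simp
  also have "\<dots> \<le> h p" unfolding h_def using b(1) by (intro member_le_sum) auto
  finally have "occ \<omega> p q j n p * exp b \<le> occ \<omega> p q j n p * h p"
    by (intro mult_left_mono occ_nonneg)
  with 1 show "occ \<omega> p q j n p \<le> real_of_int q * exp (a - b)"
    by (simp add: exp_diff field_simps)
qed simp

text \<open>The mirror image, with the harmonic function that vanishes at \<open>p\<close>;
  \<open>h 0\<close> now has \<open>- p\<close> terms, at the sites from \<open>p\<close> to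
  -1.\<close>

lemma prob_reaches_right_le:
  assumes \<omega>: "\<And>y. 0 < \<omega> y \<and> \<omega> y < 1" and pq: "p < 0" "0 < q"
    and a: "\<And>x. x \<in> {p..<0} \<Longrightarrow> potential \<omega> x \<le> a" and b: "x0 \<in> {p..<q}" "b \<le> potential \<omega> x0"
  shows "unifs.prob {U \<in> space unifs. \<exists>n. stopped \<omega> p q j n U = q} \<le> - real_of_int p * exp (a - b)"
proof (rule prob_reaches_le)
  fix n
  define h where "h y = (\<Sum>x\<in>{p..<y}. exp (potential \<omega> x))" for y
  have h_rec: "h (y + 1) = exp (potential \<omega> y) + h y" if "p \<le> y" for y
  proof -
    have "{p..<y + 1} = insert y {p..<y}" using that by auto
    then show ?thesis unfolding h_def by simp
  qed
  have "occ \<omega> p q j n q * h q \<le> h 0"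
  proof (rule occ_harmonic_le)
    fix y assume y: "p < y" "y < q"
    have "h (y + 1) = exp (potential \<omega> y) + h y" "h y = exp (potential \<omega> (y - 1)) + h (y - 1)"
      using h_rec[of y] h_rec[of "y - 1"] y by auto
    then show "\<omega> y * h (y + 1) + (1 - \<omega> y) * h (y - 1) = h y"
      using exp_potential_step[of \<omega> y] \<omega>[of y] by (simp add: algebra_simps)
  qed (use pq \<omega> in \<open>auto simp: h_def less_imp_le intro: sum_nonneg\<close>)
  also have "h 0 \<le> (\<Sum>x\<in>{p..<0}. exp a)"
    unfolding h_def using a by (intro sum_mono) auto
  also have "\<dots> = - real_of_int p * exp a" using pq by simp
  finally have 1: "occ \<omega> p q j n q * h q \<le> - real_of_int p * exp a" .
  have "exp b \<le> exp (potential \<omega> x0)" using b by simp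
  also have "\<dots> \<le> h q" unfolding h_def using b(1) by (intro member_le_sum) auto
  finally have "occ \<omega> p q j n q * exp b \<le> occ \<omega> p q j n q * h q"
    by (intro mult_left_mono occ_nonneg)
  with 1 show "occ \<omega> p q j n q \<le> - real_of_int p * exp (a - b)"
    by (simp add: exp_diff field_simps)
qed simp

section \<open>Window maxima and the quenched law of the right end\<close>

definition max_right :: "(int \<Rightarrow> real) \<Rightarrow> nat \<Rightarrow> real" where
  "max_right \<omega> k = Max ((\<lambda>i. potential \<omega> (int i)) ` {..k})"

definition max_left :: "(int \<Rightarrow> real) \<Rightarrow> nat \<Rightarrow> real" where
  "max_left \<omega> k = Max ((\<lambda>i. potential \<omega> (- int i)) ` {..k})"

lemma potential_le_max_right: "0 \<le> x \<Longrightarrow> x \<le> int k \<Longrightarrow> potential \<omega> x \<le> max_right \<omega> k"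
  unfolding max_right_def by (rule Max_ge) (auto intro!: image_eqI[of _ _ "nat x"])

lemma potential_le_max_left: "x \<le> 0 \<Longrightarrow> - int k \<le> x \<Longrightarrow> potential \<omega> x \<le> max_left \<omega> k"
  unfolding max_left_def by (rule Max_ge) (auto intro!: image_eqI[of _ _ "nat (- x)"])

lemma max_right_attained: "\<exists>x. 0 \<le> x \<and> x \<le> int k \<and> max_right \<omega> k = potential \<omega> x"
proof -
  have "max_right \<omega> k \<in> (\<lambda>i. potential \<omega> (int i)) ` {..k}"
    unfolding max_right_def by (rule Max_in) auto
  then obtain i where "i \<le> k" "max_right \<omega> k = potential \<omega> (int i)" by auto
  then show ?thesis by (intro exI[of _ "int i"]) auto
qed

lemma max_left_attained: "\<exists>x. x \<le> 0 \<and> - int k \<le> x \<and> max_left \<omega> k = potential \<omega> x"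
proof -
  have "max_left \<omega> k \<in> (\<lambda>i. potential \<omega> (- int i)) ` {..k}"
    unfolding max_left_def by (rule Max_in) auto
  then obtain i where "i \<le> k" "max_left \<omega> k = potential \<omega> (- int i)" by auto
  then show ?thesis by (intro exI[of _ "- int i"]) auto
qed

text \<open>If the right end is below \<open>q\<close> after \<open>n\<close> particles, the left end has reached \<open>p = q - 1 - n\<close>, so one of the
  \<open>n\<close> walks hit \<open>p\<close> before \<open>q\<close>. The same \<open>p\<close> serves the complementary event.\<close>

lemma quenched_dright_less:
  assumes \<omega>: "\<And>y. 0 < \<omega> y \<and> \<omega> y < 1" and q: "1 \<le> q" "q \<le> n"
  shows "unifs.prob {U \<in> space unifs. dright \<omega> U n < int q}
    \<le> (real n)\<^sup>2 * exp (max_right \<omega> (q - 1) - max_left \<omega> (n + 1 - q))"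
proof -
  define p where "p = int q - 1 - int n"
  let ?a = "max_right \<omega> (q - 1)" and ?b = "max_left \<omega> (n + 1 - q)"
  let ?B = "\<lambda>j. {U \<in> space unifs. \<exists>m. stopped \<omega> p (int q) (Suc j) m U = p}"
  have p: "p < 0" "0 < int q" "- p = int (n + 1 - q)" using q by (auto simp: p_def of_nat_diff)
  obtain x0 where x0: "x0 \<le> 0" "p \<le> x0" "?b = potential \<omega> x0"
    using max_left_attained[of "n + 1 - q" \<omega>] p by auto
  have "unifs.prob {U \<in> space unifs. dright \<omega> U n < int q} \<le> unifs.prob (\<Union>j<n. ?B j)"
  proof (rule unifs.finite_measure_mono_AE)
    \<comment> \<open>The inclusion uses the exact width of the cluster, which is available for
      almost every \<open>U\<close> only.\<close>
    show "AE U in unifs. U \<in> {U \<in> space unifs. dright \<omega> U n < int q} \<longrightarrow> U \<in> (\<Union>j<n. ?B j)"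
      using AE_walk_exits[where \<omega> = \<omega>, OF \<omega>]
    proof eventually_elim
      case (elim U)
      obtain g d where gd: "g \<le> 0" "0 \<le> d" "cluster \<omega> U n = {g..d}" "d - g = int n"
        using cluster_width[of \<omega> U n] elim by blast
      have dr: "dright \<omega> U n = d" using dright_interval[OF gd(3)] gd by simp
      show ?case
      proof
        assume U: "U \<in> {U \<in> space unifs. dright \<omega> U n < int q}"
        then have "d < int q" by (simp add: dr)
        then have "p \<in> cluster \<omega> U n" "\<And>y. y \<in> cluster \<omega> U n \<Longrightarrow> y < int q"
          using gd p(1) by (auto simp: p_def)
        then obtain j m where j: "j < n" "walk \<omega> U (Suc j) m = p"
            "\<And>k. k < m \<Longrightarrow> p < walk \<omega> U (Suc j) k \<and> walk \<omega> U (Suc j) k < int q"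
          using cluster_hit_left[OF p(1)] by meson
        have "stopped \<omega> p (int q) (Suc j) m U = p" using stopped_eq_walk[OF j(3)] j(2) by simp
        then show "U \<in> (\<Union>j<n. ?B j)" using j(1) U by auto
      qed
    qed
  qed measurable
  also have "\<dots> \<le> (\<Sum>j<n. unifs.prob (?B j))" by (intro measure_UNION_le) auto
  also have "\<dots> \<le> (\<Sum>j<n. real_of_int (int q) * exp (?a - ?b))"
  proof (intro sum_mono prob_reaches_left_le[OF \<omega> p(1,2)])
    show "potential \<omega> x \<le> ?a" if "x \<in> {0..<int q}" for x
      using that q by (intro potential_le_max_right) (auto simp: of_nat_diff)
    show "x0 \<in> {p..<int q}" "?b \<le> potential \<omega> x0" using x0 p by auto
  qed
  also have "\<dots> = real n * real q * exp (?a - ?b)" by simp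
  also have "\<dots> \<le> (real n)\<^sup>2 * exp (?a - ?b)"
    using q by (intro mult_right_mono) (auto simp: power2_eq_square intro!: mult_left_mono)
  finally show ?thesis .
qed

text \<open>If the right end is at least \<open>q\<close>, the left end is at least
  \<open>q - n = p + 1\<close>. So the walk that brought \<open>q\<close> into the cluster hit
  \<open>q\<close> before \<open>p\<close>, and the two maxima exchange their roles.\<close>

lemma quenched_dright_ge:
  assumes \<omega>: "\<And>y. 0 < \<omega> y \<and> \<omega> y < 1" and q: "1 \<le> q" "q \<le> n"
  shows "unifs.prob {U \<in> space unifs. \<not> dright \<omega> U n < int q}
    \<le> (real n)\<^sup>2 * exp (max_left \<omega> (n + 1 - q) - max_right \<omega> (q - 1))"
proof -
  define p where "p = int q - 1 - int n"
  let ?b = "max_right \<omega> (q - 1)" and ?a = "max_left \<omega> (n + 1 - q)"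
  let ?B = "\<lambda>j. {U \<in> space unifs. \<exists>m. stopped \<omega> p (int q) (Suc j) m U = int q}"
  have p: "p < 0" "0 < int q" "- p = int (n + 1 - q)" using q by (auto simp: p_def of_nat_diff)
  obtain x0 where x0: "0 \<le> x0" "x0 < int q" "?b = potential \<omega> x0"
    using max_right_attained[of "q - 1" \<omega>] q by (auto simp: of_nat_diff)
  have "unifs.prob {U \<in> space unifs. \<not> dright \<omega> U n < int q} \<le> unifs.prob (\<Union>j<n. ?B j)"
  proof (rule unifs.finite_measure_mono_AE)
    show "AE U in unifs. U \<in> {U \<in> space unifs. \<not> dright \<omega> U n < int q} \<longrightarrow> U \<in> (\<Union>j<n. ?B j)"
      using AE_walk_exits[where \<omega> = \<omega>, OF \<omega>]
    proof eventually_elim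
      case (elim U)
      obtain g d where gd: "g \<le> 0" "0 \<le> d" "cluster \<omega> U n = {g..d}" "d - g = int n"
        using cluster_width[of \<omega> U n] elim by blast
      have dr: "dright \<omega> U n = d" using dright_interval[OF gd(3)] gd by simp
      show ?case
      proof
        assume U: "U \<in> {U \<in> space unifs. \<not> dright \<omega> U n < int q}"
        then have "int q \<le> d" by (simp add: dr)
        then have "int q \<in> cluster \<omega> U n" "\<And>y. y \<in> cluster \<omega> U n \<Longrightarrow> p < y"
          using gd p(2) by (auto simp: p_def)
        then obtain j m where j: "j < n" "walk \<omega> U (Suc j) m = int q"
            "\<And>k. k < m \<Longrightarrow> p < walk \<omega> U (Suc j) k \<and> walk \<omega> U (Suc j) k < int q"
          using cluster_hit_right[OF p(2)] by meson
        have "stopped \<omega> p (int q) (Suc j) m U = int q" using stopped_eq_walk[OF j(3)] j(2) by simp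
        then show "U \<in> (\<Union>j<n. ?B j)" using j(1) U by auto
      qed
    qed
  qed measurable
  also have "\<dots> \<le> (\<Sum>j<n. unifs.prob (?B j))" by (intro measure_UNION_le) auto
  also have "\<dots> \<le> (\<Sum>j<n. - real_of_int p * exp (?a - ?b))"
  proof (intro sum_mono prob_reaches_right_le[OF \<omega> p(1,2)])
    show "potential \<omega> x \<le> ?a" if "x \<in> {p..<0}" for x
      using that p by (intro potential_le_max_left) auto
    show "x0 \<in> {p..<int q}" "?b \<le> potential \<omega> x0" using x0 p by auto
  qed
  also have "\<dots> = real n * real (n + 1 - q) * exp (?a - ?b)"
    using p(3) by (simp del: of_nat_diff flip: of_int_minus)
  also have "\<dots> \<le> (real n)\<^sup>2 * exp (?a - ?b)"
    using q by (intro mult_right_mono) (auto simp: power2_eq_square intro!: mult_left_mono)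
  finally show ?thesis .
qed

text \<open>Replaces the least exit time by countable quantifiers over times and integer end points,
  a form from which measurability can be read off. The first exit time is unique, so both sides pick
  the same point.\<close>

lemma cluster_Suc_eq_iff:
  "cluster \<omega> U (Suc n) = A \<longleftrightarrow> (\<exists>g d. cluster \<omega> U n = {g..d} \<and>
     ((\<exists>m. walk \<omega> U (Suc n) m \<notin> {g..d} \<and> (\<forall>k<m. walk \<omega> U (Suc n) k \<in> {g..d}) \<and>
          insert (walk \<omega> U (Suc n) m) {g..d} = A)
      \<or> (\<forall>m. walk \<omega> U (Suc n) m \<in> {g..d}) \<and> {g..d} = A))" (is "?L \<longleftrightarrow> ?R")
proof -
  obtain g d where gd: "cluster \<omega> U n = {g..d}" using cluster_interval by blast
  define P where "P m \<longleftrightarrow> walk \<omega> U (Suc n) m \<notin> {g..d}" for m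
  have first: "P m \<and> (\<forall>k<m. \<not> P k) \<longleftrightarrow> (\<exists>m. P m) \<and> m = (LEAST m. P m)" for m
    using LeastI_ex[of P] not_less_Least[of _ P] Least_equality[of P m]
    by (metis linorder_not_less)
  have "?R \<longleftrightarrow> ((\<exists>m. P m \<and> (\<forall>k<m. \<not> P k) \<and> insert (walk \<omega> U (Suc n) m) {g..d} = A)
      \<or> (\<forall>m. \<not> P m) \<and> {g..d} = A)"
    unfolding gd P_def by (auto 0 4)
  also have "\<dots> \<longleftrightarrow> (if \<exists>m. P m then insert (walk \<omega> U (Suc n) (LEAST m. P m)) {g..d} else {g..d}) = A"
    using first by (smt (verit, best))
  also have "\<dots> \<longleftrightarrow> ?L" unfolding cluster.simps Let_def gd P_def ..
  finally show ?thesis by simp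
qed

section \<open>The annealed law\<close>

locale environment = prob_space mu for mu :: "real measure" +
  assumes sets_mu: "sets mu = sets borel"
begin

abbreviation env :: "(int \<Rightarrow> real) measure" where
  "env \<equiv> PiM UNIV (\<lambda>_. mu)"

sublocale env: prob_space env
  by (rule prob_space_PiM) (rule prob_space_axioms)

sublocale ann: pair_prob_space env unifs ..

lemma annealed_space_eq: "annealed_space mu = env \<Otimes>\<^sub>M unifs"
  by (simp add: annealed_space_def)

section \<open>Measurability on the annealed space\<close>

lemma env_component_measurable [measurable]: "(\<lambda>z. fst z y) \<in> borel_measurable (env \<Otimes>\<^sub>M unifs)"
  using measurable_compose[OF measurable_fst measurable_component_singleton[of y UNIV "\<lambda>_. mu"]]
  by (simp cong: measurable_cong_sets add: sets_mu)

lemma unif_component_measurable [measurable]: "(\<lambda>z. snd z k) \<in> borel_measurable (env \<Otimes>\<^sub>M unifs)"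
  using measurable_compose[OF measurable_snd measurable_component_singleton[of k UNIV "\<lambda>_. unif"]]
  by (simp cong: measurable_cong_sets)

lemma walk_measurable [measurable]:
  "(\<lambda>z. walk (fst z) (snd z) j n) \<in> measurable (env \<Otimes>\<^sub>M unifs) (count_space UNIV)"
proof (induction n)
  case (Suc n)
  have "(\<lambda>z. (\<lambda>y z. y + (if snd z (j, n) < fst z y then 1 else -1)) (walk (fst z) (snd z) j n) z)
      \<in> measurable (env \<Otimes>\<^sub>M unifs) (count_space UNIV)"
    by (rule measurable_compose_countable[OF _ Suc]) measurable
  then show ?case by simp
qed simp

lemma cluster_measurable [measurable]:
  "Measurable.pred (env \<Otimes>\<^sub>M unifs) (\<lambda>z. cluster (fst z) (snd z) n = A)"
proof (induction n arbitrary: A)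
  case (Suc n)
  note [measurable] = Suc
  have [measurable]: "Measurable.pred (env \<Otimes>\<^sub>M unifs) (\<lambda>z. Q (walk (fst z) (snd z) j m))" for Q j m
    by (rule measurable_compose[OF walk_measurable]) simp
  have w: "Measurable.pred (env \<Otimes>\<^sub>M unifs) (\<lambda>z. insert (walk (fst z) (snd z) (Suc n) m) {g..d} = A)"
    "Measurable.pred (env \<Otimes>\<^sub>M unifs) (\<lambda>z. walk (fst z) (snd z) (Suc n) m \<in> {g..d})" for m g d
    by (rule measurable_compose[OF walk_measurable], simp)+
  note [measurable] = w
  show ?case unfolding cluster_Suc_eq_iff by measurable
qed simp

lemma dright_measurable [measurable]:
  "(\<lambda>z. dright (fst z) (snd z) n) \<in> measurable (env \<Otimes>\<^sub>M unifs) (count_space UNIV)"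
proof (subst measurable_count_space_eq2_countable, intro conjI ballI)
  fix d :: int
  have "dright \<omega> U n = d \<longleftrightarrow> (\<exists>g. g \<le> d \<and> cluster \<omega> U n = {g..d})" for \<omega> U
  proof -
    obtain g' d' where gd: "g' \<le> 0" "0 \<le> d'" "cluster \<omega> U n = {g'..d'}" using cluster_interval by blast
    then have "dright \<omega> U n = d'" using dright_interval[OF gd(3)] by simp
    moreover have "g' \<le> d'" using gd by simp
    ultimately show ?thesis using gd(3) by (metis atLeastatMost_subset_iff order_antisym order_refl)
  qed
  then have "(\<lambda>z. dright (fst z) (snd z) n) -` {d} \<inter> space (env \<Otimes>\<^sub>M unifs)
      = {z \<in> space (env \<Otimes>\<^sub>M unifs). \<exists>g. g \<le> d \<and> cluster (fst z) (snd z) n = {g..d}}" by auto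
  also have "\<dots> \<in> sets (env \<Otimes>\<^sub>M unifs)" by measurable
  finally show "(\<lambda>z. dright (fst z) (snd z) n) -` {d} \<inter> space (env \<Otimes>\<^sub>M unifs) \<in> sets (env \<Otimes>\<^sub>M unifs)" .
qed auto

text \<open>Fubini: environments in \<open>G\<close> contribute at most their probability, almost
  all others at most the quenched bound.\<close>

lemma annealed_le:
  assumes Z: "Z \<in> sets (env \<Otimes>\<^sub>M unifs)" and G: "G \<in> sets env" and \<delta>: "\<delta> \<ge> 0"
    and le: "AE \<omega> in env. \<omega> \<notin> G \<longrightarrow> unifs.prob (Pair \<omega> -` Z) \<le> \<delta>"
  shows "ann.prob Z \<le> env.prob G + \<delta>"
proof -
  have "emeasure (env \<Otimes>\<^sub>M unifs) Z = (\<integral>\<^sup>+\<omega>. emeasure unifs (Pair \<omega> -` Z) \<partial>env)"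
    by (rule unifs.emeasure_pair_measure_alt[OF Z])
  also have "\<dots> \<le> (\<integral>\<^sup>+\<omega>. indicator G \<omega> + ennreal \<delta> \<partial>env)"
  proof (rule nn_integral_mono_AE)
    show "AE \<omega> in env. emeasure unifs (Pair \<omega> -` Z) \<le> indicator G \<omega> + ennreal \<delta>"
      using le
    proof eventually_elim
      case (elim \<omega>)
      show ?case
      proof (cases "\<omega> \<in> G")
        case True
        have "emeasure unifs (Pair \<omega> -` Z) \<le> 1" by (rule unifs.emeasure_le_1)
        also have "\<dots> \<le> indicator G \<omega> + ennreal \<delta>" using True by simp
        finally show ?thesis .
      next
        case False
        then show ?thesis using elim \<delta> by (simp add: unifs.emeasure_eq_measure)
      qed
    qed
  qed
  also have "\<dots> = emeasure env G + ennreal \<delta>"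
    using G by (subst nn_integral_add) (auto simp: env.emeasure_space_1)
  also have "\<dots> = ennreal (env.prob G + \<delta>)"
    using \<delta> by (simp add: env.emeasure_eq_measure)
  finally have "ennreal (ann.prob Z) \<le> ennreal (env.prob G + \<delta>)"
    unfolding ann.emeasure_eq_measure .
  then show ?thesis
    using \<delta> by (simp del: ennreal_plus)
qed

text \<open>A general \<open>f\<close> and an injective choice \<open>g\<close> of sites let one
  lemma cover both halves of the potential. Independence comes from grouping the coordinates into
  the disjoint singletons \<open>{g j}\<close>.\<close>

lemma coordinate_iid:
  fixes f :: "real \<Rightarrow> real" and g :: "nat \<Rightarrow> int"
  assumes f [measurable]: "f \<in> borel_measurable borel" and g: "inj g"
    and mean: "expectation f = 0" and sq: "integrable mu (\<lambda>x. (f x)\<^sup>2)"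
    and var: "expectation (\<lambda>x. (f x)\<^sup>2) = \<sigma>\<^sup>2" and \<sigma>: "\<sigma> > 0"
  shows "centered_iid env (\<lambda>i \<omega>. f (\<omega> (g i))) (distr mu borel f) \<sigma>"
proof (intro centered_iid.intro env.prob_space_axioms centered_iid_axioms.intro)
  have fm [measurable]: "f \<in> borel_measurable mu"
    using f by (simp cong: measurable_cong_sets add: sets_mu)
  have comp [measurable]: "(\<lambda>\<omega>. \<omega> i) \<in> measurable env mu" for i
    by (rule measurable_component_singleton) simp
  have d: "distr env mu (\<lambda>\<omega>. \<omega> i) = mu" for i
    by (rule distr_PiM_component) (auto intro: prob_space_axioms)
  have E: "env.expectation (\<lambda>\<omega>. h (\<omega> i)) = expectation h" if "h \<in> borel_measurable mu" for h :: "real \<Rightarrow> real" and i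
    using integral_distr[OF comp that, of i] by (simp add: d)
  have "env.indep_vars (\<lambda>j. PiM {g j} (\<lambda>_. mu)) (\<lambda>j \<omega>. restrict (\<lambda>i. \<omega> i) {g j}) UNIV"
    using g by (intro env.indep_vars_restrict[OF indep_vars_PiM_coordinates])
      (auto simp: prob_space_axioms disjoint_family_on_def inj_def)
  then have "env.indep_vars (\<lambda>_. borel) (\<lambda>j \<omega>. (\<lambda>u. f (u (g j))) (restrict (\<lambda>i. \<omega> i) {g j})) UNIV"
  proof (rule env.indep_vars_compose2)
    show "(\<lambda>u. f (u (g i))) \<in> borel_measurable (PiM {g i} (\<lambda>_. mu))" for i
      by (rule measurable_compose[OF measurable_component_singleton[of "g i" "{g i}" "\<lambda>_. mu"] fm]) simp
  qed
  then show "env.indep_vars (\<lambda>i. borel) (\<lambda>i \<omega>. f (\<omega> (g i))) UNIV" by simp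
  show mean0: "env.expectation (\<lambda>\<omega>. f (\<omega> (g n))) = 0" for n by (simp add: E mean)
  show "env.variance (\<lambda>\<omega>. f (\<omega> (g n))) = \<sigma>\<^sup>2" for n
    using E[of "\<lambda>x. (f x)\<^sup>2" "g n"] by (simp add: mean0 var)
  show "integrable env (\<lambda>\<omega>. (f (\<omega> (g n)))\<^sup>2)" for n
    using integrable_distr[OF comp, of "g n" "\<lambda>x. (f x)\<^sup>2"] sq by (simp add: d)
  show "distr env borel (\<lambda>\<omega>. f (\<omega> (g n))) = distr mu borel f" for n
    by (subst (2) d[symmetric, of "g n"], subst distr_distr) (auto simp: comp_def)
qed (rule \<sigma>)

text \<open>\<open>A\<close> is general because the maximum is viewed both on the whole environment
  and on its restriction to the positive sites, where independence is obtained.\<close>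

lemma max_right_measurable:
  assumes "{1..} \<subseteq> A"
  shows "(\<lambda>u. max_right u k) \<in> borel_measurable (PiM A (\<lambda>_. mu))"
proof -
  have "log_ratio \<in> borel_measurable mu" by (simp cong: measurable_cong_sets add: sets_mu)
  then show ?thesis
    unfolding max_right_def[abs_def] potential_nat using assms
    by (intro borel_measurable_Max borel_measurable_sum)
       (auto intro!: measurable_compose[OF measurable_component_singleton])
qed

lemma max_left_measurable:
  assumes "{..0} \<subseteq> A"
  shows "(\<lambda>u. max_left u k) \<in> borel_measurable (PiM A (\<lambda>_. mu))"
proof -
  have "log_ratio \<in> borel_measurable mu" by (simp cong: measurable_cong_sets add: sets_mu)
  then show ?thesis
    unfolding max_left_def[abs_def] potential_uminus_nat using assms
    by (intro borel_measurable_Max borel_measurable_sum borel_measurable_uminus)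
       (auto intro!: measurable_compose[OF measurable_component_singleton])
qed

lemma max_right_env_measurable [measurable]: "(\<lambda>\<omega>. max_right \<omega> k) \<in> borel_measurable env"
  by (rule max_right_measurable) simp

lemma max_left_env_measurable [measurable]: "(\<lambda>\<omega>. max_left \<omega> k) \<in> borel_measurable env"
  by (rule max_left_measurable) simp

lemma indep_max: "env.indep_var borel (\<lambda>\<omega>. max_right \<omega> k) borel (\<lambda>\<omega>. max_left \<omega> l)"
proof -
  let ?A = "{1::int..}" and ?B = "{..0::int}"
  have "env.indep_var (PiM ?A (\<lambda>_. mu)) (\<lambda>\<omega>. restrict (\<lambda>i. \<omega> i) ?A) (PiM ?B (\<lambda>_. mu)) (\<lambda>\<omega>. restrict (\<lambda>i. \<omega> i) ?B)"
    by (rule env.indep_var_restrict[OF indep_vars_PiM_coordinates]) (auto simp: prob_space_axioms)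
  then have "env.indep_var borel ((\<lambda>u. max_right u k) \<circ> (\<lambda>\<omega>. restrict (\<lambda>i. \<omega> i) ?A))
      borel ((\<lambda>u. max_left u l) \<circ> (\<lambda>\<omega>. restrict (\<lambda>i. \<omega> i) ?B))"
    by (rule env.indep_var_compose) (auto intro!: max_right_measurable max_left_measurable)
  moreover have "max_right (restrict \<omega> ?A) k = max_right \<omega> k" for \<omega>
    unfolding max_right_def potential_nat by simp
  moreover have "max_left (restrict \<omega> ?B) l = max_left \<omega> l" for \<omega>
    unfolding max_left_def potential_uminus_nat by simp
  ultimately show ?thesis by (simp add: comp_def)
qed

end

locale sinai_environment = environment +
  assumes elliptic: "AE x in mu. 0 < x \<and> x < 1"
    and mean_zero: "expectation log_ratio = 0"
    and square_integrable: "integrable mu (\<lambda>x. (log_ratio x)\<^sup>2)"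
    and nondegenerate: "0 < expectation (\<lambda>x. (log_ratio x)\<^sup>2)"
begin

definition \<sigma> :: real where
  "\<sigma> = sqrt (expectation (\<lambda>x. (log_ratio x)\<^sup>2))"

lemma \<sigma>: "\<sigma> > 0" "\<sigma>\<^sup>2 = expectation (\<lambda>x. (log_ratio x)\<^sup>2)"
  using nondegenerate by (auto simp: \<sigma>_def)

sublocale R: centered_iid env "\<lambda>i \<omega>. log_ratio (\<omega> (int i + 1))" "distr mu borel log_ratio" \<sigma>
  using mean_zero square_integrable \<sigma> by (intro coordinate_iid) (auto simp: inj_def)

sublocale L: centered_iid env "\<lambda>i \<omega>. - log_ratio (\<omega> (- int i))" "distr mu borel (\<lambda>x. - log_ratio x)" \<sigma>
  using mean_zero square_integrable \<sigma>
  by (intro coordinate_iid[of "\<lambda>x. - log_ratio x"]) (auto simp: inj_def)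

lemma max_right_eq: "max_right \<omega> k = R.maxS k \<omega>"
  by (simp add: max_right_def R.maxS_def R.S_def potential_nat)

lemma max_left_eq: "max_left \<omega> k = L.maxS k \<omega>"
  by (simp add: max_left_def L.maxS_def L.S_def potential_uminus_nat)

text \<open>The vanishing factor \<open>s\<close> accommodates the margin of the quenched bounds; it
  is applied with both signs.\<close>

lemma max_difference_limit:
  fixes q :: "nat \<Rightarrow> nat"
  assumes x: "0 < x" "x < 1" and q: "(\<lambda>n. real (q n) / real n) \<longlonglongrightarrow> x" and s: "s \<longlonglongrightarrow> 0"
  shows "(\<lambda>n. env.prob {\<omega> \<in> space env. max_right \<omega> (q n - 1) - max_left \<omega> (n + 1 - q n) \<le> s n * (\<sigma> * sqrt n)})
    \<longlonglongrightarrow> 1 - 2 / pi * arcsin (sqrt x)"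
proof -
  have inv: "(\<lambda>n. 1 / real n) \<longlonglongrightarrow> 0" by real_asymp
  \<comment> \<open>Subtraction on \<open>nat\<close> is truncated, but \<open>1 \<le> q n\<close>
    and \<open>q n \<le> n\<close> hold eventually because the limit lies strictly between 0 and
    1.\<close>
  have ev: "eventually (\<lambda>n. 0 < real (q n) / real n) sequentially" "eventually (\<lambda>n. real (q n) / real n < 1) sequentially"
    using order_tendstoD[OF q] x by auto
  have q1: "(\<lambda>n. real (q n - 1) / real n) \<longlonglongrightarrow> x"
  proof (rule Lim_transform_eventually)
    show "(\<lambda>n. real (q n) / real n - 1 / real n) \<longlonglongrightarrow> x" using tendsto_diff[OF q inv] by simp
    show "eventually (\<lambda>n. real (q n) / real n - 1 / real n = real (q n - 1) / real n) sequentially"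
      using ev(1)
    proof eventually_elim
      case (elim n)
      then have "q n \<ge> 1" by (cases "q n") auto
      then show ?case by (simp add: of_nat_diff diff_divide_distrib)
    qed
  qed
  have q2: "(\<lambda>n. real (n + 1 - q n) / real n) \<longlonglongrightarrow> 1 - x"
  proof (rule Lim_transform_eventually)
    show "(\<lambda>n. 1 + 1 / real n - real (q n) / real n) \<longlonglongrightarrow> 1 - x"
      using tendsto_diff[OF tendsto_add[OF tendsto_const inv] q, of 1] by simp
    show "eventually (\<lambda>n. 1 + 1 / real n - real (q n) / real n = real (n + 1 - q n) / real n) sequentially"
      using ev(2) eventually_gt_at_top[of 0]
    proof eventually_elim
      case (elim n)
      then have "q n \<le> n" by (simp add: divide_less_eq)
      then show ?case using elim(2) by (simp add: of_nat_diff diff_divide_distrib add_divide_distrib)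
    qed
  qed
  let ?X = "\<lambda>n \<omega>. max_right \<omega> (q n - 1) / (\<sigma> * sqrt n)" and ?Y = "\<lambda>n \<omega>. max_left \<omega> (n + 1 - q n) / (\<sigma> * sqrt n)"
  have w: "weak_conv_m (\<lambda>n. distr env borel (\<lambda>\<omega>. ?X n \<omega> - ?Y n \<omega>)) (limit_diff x)"
    unfolding limit_diff_def
  proof (rule env.weak_conv_diff)
    fix n
    have "env.indep_var borel ((\<lambda>y. y / (\<sigma> * sqrt n)) \<circ> (\<lambda>\<omega>. max_right \<omega> (q n - 1)))
        borel ((\<lambda>y. y / (\<sigma> * sqrt n)) \<circ> (\<lambda>\<omega>. max_left \<omega> (n + 1 - q n)))"
      by (rule env.indep_var_compose[OF indep_max]) auto
    then show "env.indep_var borel (?X n) borel (?Y n)" by (simp add: comp_def)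
  next
    show "weak_conv_m (\<lambda>n. distr env borel (?X n)) (distr abs_normal borel (\<lambda>y. sqrt x * y))"
      unfolding max_right_eq by (rule R.maxS_weak_conv[OF x(1) q1])
    show "weak_conv_m (\<lambda>n. distr env borel (?Y n)) (distr abs_normal borel (\<lambda>y. sqrt (1 - x) * y))"
      unfolding max_left_eq using x(2) by (intro L.maxS_weak_conv q2) simp
  qed (rule scaled_abs_normal_distribution)+
  define F where "F n = cdf (distr env borel (\<lambda>\<omega>. ?X n \<omega> - ?Y n \<omega>))" for n
  have "mono (F n)" for n
  proof -
    interpret D: real_distribution "distr env borel (\<lambda>\<omega>. ?X n \<omega> - ?Y n \<omega>)"
      by (intro env.real_distribution_distr) simp
    show ?thesis unfolding F_def by (intro monoI D.cdf_nondecreasing)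
  qed
  moreover have "(\<lambda>n. F n t) \<longlonglongrightarrow> cdf (limit_diff x) t" for t
    using w isCont_cdf_limit_diff[OF x(1)] by (auto simp: weak_conv_m_def weak_conv_def F_def)
  ultimately have "(\<lambda>n. F n (s n)) \<longlonglongrightarrow> cdf (limit_diff x) 0"
    using tendsto_mono_moving_argument[of F "cdf (limit_diff x)" 0 s] isCont_cdf_limit_diff[OF x(1)] s by blast
  moreover have "eventually (\<lambda>n. F n (s n) =
      env.prob {\<omega> \<in> space env. max_right \<omega> (q n - 1) - max_left \<omega> (n + 1 - q n) \<le> s n * (\<sigma> * sqrt n)}) sequentially"
    using eventually_gt_at_top[of 0]
  proof eventually_elim
    case (elim n)
    have pos: "0 < \<sigma> * sqrt n" using elim \<sigma> by simp
    have "F n (s n) = env.prob {\<omega> \<in> space env. ?X n \<omega> - ?Y n \<omega> \<le> s n}"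
      unfolding F_def by (rule env.cdf_distr) measurable
    then show ?case using pos by (simp only: diff_divide_distrib[symmetric] pos_divide_le_eq)
  qed
  ultimately show ?thesis
    using cdf_limit_diff_0[OF x] by (simp add: Lim_transform_eventually)
qed

lemma AE_env_elliptic: "AE \<omega> in env. \<forall>y. 0 < \<omega> y \<and> \<omega> y < 1"
proof -
  have "AE \<omega> in env. 0 < \<omega> y \<and> \<omega> y < 1" for y
    by (rule AE_PiM_component[of UNIV "\<lambda>_. mu" y, OF prob_space_axioms UNIV_I elliptic])
  then show ?thesis unfolding AE_all_countable by blast
qed

lemma annealed_dright_less_limit:
  fixes q :: "nat \<Rightarrow> nat"
  assumes x: "0 < x" "x < 1" and q: "(\<lambda>n. real (q n) / real n) \<longlonglongrightarrow> x"
  shows "(\<lambda>n. ann.prob {z \<in> space (env \<Otimes>\<^sub>M unifs). dright (fst z) (snd z) n < int (q n)})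
    \<longlonglongrightarrow> 2 / pi * arcsin (sqrt x)"
proof -
  \<comment> \<open>\<open>s n\<close> tends to 0, yet \<open>s n * sqrt n = n powr (1/4)\<close>
    outgrows every multiple of \<open>ln n\<close>; hence \<open>\<delta> n\<close>, the quenched
    bound beyond the margin, vanishes.\<close>
  define s where "s n = real n powr (-1/4)" for n
  define D where "D n \<omega> = max_right \<omega> (q n - 1) - max_left \<omega> (n + 1 - q n)" for n \<omega>
  define \<delta> where "\<delta> n = (real n)\<^sup>2 * exp (- (s n * (\<sigma> * sqrt n)))" for n
  define P where "P t n = env.prob {\<omega> \<in> space env. D n \<omega> \<le> t * (\<sigma> * sqrt n)}" for t :: real and n :: nat
  let ?Z = "\<lambda>n. {z \<in> space (env \<Otimes>\<^sub>M unifs). dright (fst z) (snd z) n < int (q n)}"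
  have [measurable]: "D n \<in> borel_measurable env" for n unfolding D_def by measurable
  have [measurable]: "?Z n \<in> sets (env \<Otimes>\<^sub>M unifs)" for n by measurable
  have s0: "s \<longlonglongrightarrow> 0" unfolding s_def by real_asymp
  have \<delta>0: "\<delta> \<longlonglongrightarrow> 0" unfolding \<delta>_def s_def using \<sigma>(1) by real_asymp
  have \<delta>nn: "\<delta> n \<ge> 0" for n by (simp add: \<delta>_def)
  have ev: "eventually (\<lambda>n. 1 \<le> q n \<and> q n \<le> n) sequentially"
  proof -
    have "eventually (\<lambda>n. 0 < real (q n) / real n \<and> real (q n) / real n < 1) sequentially"
      using order_tendstoD[OF q] x by (auto intro: eventually_conj)
    then show ?thesis using eventually_gt_at_top[of 0]
      by eventually_elim (auto simp: divide_less_eq zero_less_divide_iff)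
  qed
  have upper: "ann.prob (?Z n) \<le> 1 - P (- s n) n + \<delta> n" if n: "1 \<le> q n" "q n \<le> n" for n
  proof -
    \<comment> \<open>The environments in which the bound for \<open>d_n < q\<close> is not small,
      near ties of the two maxima included.\<close>
    let ?G = "{\<omega> \<in> space env. \<not> D n \<omega> \<le> - s n * (\<sigma> * sqrt n)}"
    have "ann.prob (?Z n) \<le> env.prob ?G + \<delta> n"
    proof (rule annealed_le[OF _ _ \<delta>nn])
      show "AE \<omega> in env. \<omega> \<notin> ?G \<longrightarrow> unifs.prob (Pair \<omega> -` ?Z n) \<le> \<delta> n"
        using AE_env_elliptic AE_space
      proof eventually_elim
        case (elim \<omega>)
        have eq: "Pair \<omega> -` ?Z n = {U \<in> space unifs. dright \<omega> U n < int (q n)}"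
          using elim(2) by (auto simp: space_pair_measure)
        show ?case
        proof
          assume "\<omega> \<notin> ?G"
          then have D: "D n \<omega> \<le> - (s n * (\<sigma> * sqrt n))" using elim(2) by auto
          have "unifs.prob (Pair \<omega> -` ?Z n) \<le> (real n)\<^sup>2 * exp (D n \<omega>)"
            unfolding eq D_def using elim(1) n by (intro quenched_dright_less) auto
          also have "\<dots> \<le> \<delta> n" unfolding \<delta>_def using D by (intro mult_left_mono) auto
          finally show "unifs.prob (Pair \<omega> -` ?Z n) \<le> \<delta> n" .
        qed
      qed
    qed measurable
    also have "env.prob ?G = 1 - P (- s n) n"
      unfolding P_def by (subst env.prob_compl[symmetric]) (auto intro!: arg_cong[where f=env.prob])
    finally show ?thesis .
  qed
  have lower: "1 - P (s n) n - \<delta> n \<le> ann.prob (?Z n)" if n: "1 \<le> q n" "q n \<le> n" for n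
  proof -
    let ?G = "{\<omega> \<in> space env. D n \<omega> \<le> s n * (\<sigma> * sqrt n)}"
    let ?C = "{z \<in> space (env \<Otimes>\<^sub>M unifs). \<not> dright (fst z) (snd z) n < int (q n)}"
    have "ann.prob ?C \<le> env.prob ?G + \<delta> n"
    proof (rule annealed_le[OF _ _ \<delta>nn])
      show "AE \<omega> in env. \<omega> \<notin> ?G \<longrightarrow> unifs.prob (Pair \<omega> -` ?C) \<le> \<delta> n"
        using AE_env_elliptic AE_space
      proof eventually_elim
        case (elim \<omega>)
        have eq: "Pair \<omega> -` ?C = {U \<in> space unifs. \<not> dright \<omega> U n < int (q n)}"
          using elim(2) by (auto simp: space_pair_measure)
        show ?case
        proof
          assume "\<omega> \<notin> ?G"
          then have D: "- D n \<omega> \<le> - (s n * (\<sigma> * sqrt n))" using elim(2) by auto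
          have "unifs.prob (Pair \<omega> -` ?C) \<le> (real n)\<^sup>2 * exp (- D n \<omega>)"
            unfolding eq D_def minus_diff_eq using elim(1) n by (intro quenched_dright_ge) auto
          also have "\<dots> \<le> \<delta> n" unfolding \<delta>_def using D by (intro mult_left_mono) auto
          finally show "unifs.prob (Pair \<omega> -` ?C) \<le> \<delta> n" .
        qed
      qed
    qed measurable
    also have "env.prob ?G = P (s n) n" by (simp add: P_def)
    also have "?C = space (env \<Otimes>\<^sub>M unifs) - ?Z n" by auto
    also have "ann.prob \<dots> = 1 - ann.prob (?Z n)" by (rule ann.prob_compl) simp
    finally show ?thesis by simp
  qed
  have lims: "(\<lambda>n. P (- s n) n) \<longlonglongrightarrow> 1 - 2 / pi * arcsin (sqrt x)" "(\<lambda>n. P (s n) n) \<longlonglongrightarrow> 1 - 2 / pi * arcsin (sqrt x)"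
    unfolding P_def D_def
    using max_difference_limit[OF x q s0] max_difference_limit[OF x q, of "\<lambda>n. - s n"] tendsto_minus[OF s0] by auto
  show ?thesis
  proof (rule tendsto_sandwich)
    show "eventually (\<lambda>n. 1 - P (s n) n - \<delta> n \<le> ann.prob (?Z n)) sequentially"
      using ev by eventually_elim (auto intro: lower)
    show "eventually (\<lambda>n. ann.prob (?Z n) \<le> 1 - P (- s n) n + \<delta> n) sequentially"
      using ev by eventually_elim (auto intro: upper)
    show "(\<lambda>n. 1 - P (s n) n - \<delta> n) \<longlonglongrightarrow> 2 / pi * arcsin (sqrt x)"
      using tendsto_diff[OF tendsto_diff[OF tendsto_const[of 1] lims(2)] \<delta>0] by simp
    show "(\<lambda>n. 1 - P (- s n) n + \<delta> n) \<longlonglongrightarrow> 2 / pi * arcsin (sqrt x)"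
      using tendsto_add[OF tendsto_diff[OF tendsto_const[of 1] lims(1)] \<delta>0] by simp
  qed
qed

section \<open>From integer thresholds to the rescaled right end\<close>

definition scaled :: "nat \<Rightarrow> (int \<Rightarrow> real) \<times> (nat \<times> nat \<Rightarrow> real) \<Rightarrow> real" where
  "scaled n z = real_of_int (dright (fst z) (snd z) n) / real n"

lemma scaled_measurable [measurable]: "scaled n \<in> borel_measurable (env \<Otimes>\<^sub>M unifs)"
  unfolding scaled_def[abs_def]
  by (rule measurable_compose[OF dright_measurable]) simp

text \<open>An integer is below \<open>x * n\<close> exactly when it is below the ceiling of
  \<open>x * n\<close>, and rounding does not change the limit \<open>x\<close> of the
  ratio.\<close>

lemma scaled_less_limit_interior:
  assumes x: "0 < x" "x < 1"
  shows "(\<lambda>n. ann.prob {z \<in> space (env \<Otimes>\<^sub>M unifs). scaled n z < x}) \<longlonglongrightarrow> 2 / pi * arcsin (sqrt x)"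
proof -
  define q where "q n = nat \<lceil>x * real n\<rceil>" for n
  have "\<lceil>x * real n\<rceil> \<ge> 0" for n
    using ceiling_mono[of 0 "x * real n"] x by simp
  then have qr: "real (q n) = real_of_int \<lceil>x * real n\<rceil>" "int (q n) = \<lceil>x * real n\<rceil>" for n
    by (auto simp: q_def)
  have "(\<lambda>n. real (q n) / real n) \<longlonglongrightarrow> x" unfolding qr by real_asymp
  from annealed_dright_less_limit[OF x this] show ?thesis
  proof (rule Lim_transform_eventually)
    show "eventually (\<lambda>n. ann.prob {z \<in> space (env \<Otimes>\<^sub>M unifs). dright (fst z) (snd z) n < int (q n)}
        = ann.prob {z \<in> space (env \<Otimes>\<^sub>M unifs). scaled n z < x}) sequentially"
      using eventually_gt_at_top[of 0]
      by eventually_elim (simp add: qr less_ceiling_iff scaled_def divide_less_eq)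
  qed
qed

text \<open>Treated apart from the strict inequality because \<open>scaled n\<close> may have atoms;
  the threshold is now the floor plus one, with the same ratio in the limit.\<close>

lemma scaled_le_limit_interior:
  assumes x: "0 < x" "x < 1"
  shows "(\<lambda>n. ann.prob {z \<in> space (env \<Otimes>\<^sub>M unifs). scaled n z \<le> x}) \<longlonglongrightarrow> 2 / pi * arcsin (sqrt x)"
proof -
  define q where "q n = nat (\<lfloor>x * real n\<rfloor> + 1)" for n
  have "\<lfloor>x * real n\<rfloor> + 1 \<ge> 0" for n using x by (simp add: add_nonneg_nonneg)
  then have qr: "real (q n) = real_of_int \<lfloor>x * real n\<rfloor> + 1" "int (q n) = \<lfloor>x * real n\<rfloor> + 1" for n
    by (auto simp: q_def)
  have "(\<lambda>n. real (q n) / real n) \<longlonglongrightarrow> x" unfolding qr by real_asymp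
  from annealed_dright_less_limit[OF x this] show ?thesis
  proof (rule Lim_transform_eventually)
    show "eventually (\<lambda>n. ann.prob {z \<in> space (env \<Otimes>\<^sub>M unifs). dright (fst z) (snd z) n < int (q n)}
        = ann.prob {z \<in> space (env \<Otimes>\<^sub>M unifs). scaled n z \<le> x}) sequentially"
      using eventually_gt_at_top[of 0]
      by eventually_elim (simp add: qr le_floor_iff scaled_def divide_le_eq)
  qed
qed

text \<open>At \<open>x = 1\<close> the left window is no longer proportional to \<open>n\<close>,
  so the limit of the maxima is not at hand. The value follows by monotonicity from points just
  below 1 and the trivial bound 1.\<close>

lemma scaled_less_limit:
  assumes "0 < x" "x \<le> 1"
  shows "(\<lambda>n. ann.prob {z \<in> space (env \<Otimes>\<^sub>M unifs). scaled n z < x}) \<longlonglongrightarrow> 2 / pi * arcsin (sqrt x)"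
proof (cases "x = 1")
  case True
  have "(\<lambda>n. ann.prob {z \<in> space (env \<Otimes>\<^sub>M unifs). scaled n z < 1}) \<longlonglongrightarrow> 1"
  proof (rule order_tendstoI)
    fix y :: real assume "y < 1"
    with arcsine_cdf_at_endpoints(2) have "eventually (\<lambda>x. y < 2 / pi * arcsin (sqrt x)) (at_left 1)"
      by (rule order_tendstoD)
    moreover have "eventually (\<lambda>x::real. x \<in> {0<..<1}) (at_left 1)"
      by (rule eventually_at_left_real) simp
    ultimately have "eventually (\<lambda>x::real. x \<in> {0<..<1} \<and> y < 2 / pi * arcsin (sqrt x)) (at_left 1)"
      by eventually_elim auto
    then obtain x :: real where x: "0 < x" "x < 1" "y < 2 / pi * arcsin (sqrt x)"
      using eventually_happens[of _ "at_left (1::real)"] by (auto simp: trivial_limit_at_left_real)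
    have "eventually (\<lambda>n. y < ann.prob {z \<in> space (env \<Otimes>\<^sub>M unifs). scaled n z < x}) sequentially"
      using scaled_less_limit_interior[OF x(1,2)] x(3) by (rule order_tendstoD)
    then show "eventually (\<lambda>n. y < ann.prob {z \<in> space (env \<Otimes>\<^sub>M unifs). scaled n z < 1}) sequentially"
    proof eventually_elim
      case (elim n)
      also have "ann.prob {z \<in> space (env \<Otimes>\<^sub>M unifs). scaled n z < x} \<le> ann.prob {z \<in> space (env \<Otimes>\<^sub>M unifs). scaled n z < 1}"
        using x by (intro ann.finite_measure_mono) auto
      finally show ?case .
    qed
  next
    fix y :: real assume "1 < y"
    then show "eventually (\<lambda>n. ann.prob {z \<in> space (env \<Otimes>\<^sub>M unifs). scaled n z < 1} < y) sequentially"
      by (intro always_eventually allI le_less_trans[OF ann.prob_le_1])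
  qed
  then show ?thesis using True by simp
qed (use assms scaled_less_limit_interior in auto)

text \<open>The counterpart at \<open>x = 0\<close>, where the right window degenerates:
  monotonicity from points just above 0 and the trivial bound 0.\<close>

lemma scaled_le_limit:
  assumes "0 \<le> x" "x < 1"
  shows "(\<lambda>n. ann.prob {z \<in> space (env \<Otimes>\<^sub>M unifs). scaled n z \<le> x}) \<longlonglongrightarrow> 2 / pi * arcsin (sqrt x)"
proof (cases "x = 0")
  case True
  have "(\<lambda>n. ann.prob {z \<in> space (env \<Otimes>\<^sub>M unifs). scaled n z \<le> 0}) \<longlonglongrightarrow> 0"
  proof (rule order_tendstoI)
    fix y :: real assume "0 < y"
    with arcsine_cdf_at_endpoints(1) have "eventually (\<lambda>x. 2 / pi * arcsin (sqrt x) < y) (at_right 0)"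
      by (rule order_tendstoD)
    moreover have "eventually (\<lambda>x::real. x \<in> {0<..<1}) (at_right 0)"
      by (rule eventually_at_right_real) simp
    ultimately have "eventually (\<lambda>x::real. x \<in> {0<..<1} \<and> 2 / pi * arcsin (sqrt x) < y) (at_right 0)"
      by eventually_elim auto
    then obtain x :: real where x: "0 < x" "x < 1" "2 / pi * arcsin (sqrt x) < y"
      using eventually_happens[of _ "at_right (0::real)"] by (auto simp: trivial_limit_at_right_real)
    have "eventually (\<lambda>n. ann.prob {z \<in> space (env \<Otimes>\<^sub>M unifs). scaled n z \<le> x} < y) sequentially"
      using scaled_le_limit_interior[OF x(1,2)] x(3) by (rule order_tendstoD)
    then show "eventually (\<lambda>n. ann.prob {z \<in> space (env \<Otimes>\<^sub>M unifs). scaled n z \<le> 0} < y) sequentially"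
    proof eventually_elim
      case (elim n)
      have "ann.prob {z \<in> space (env \<Otimes>\<^sub>M unifs). scaled n z \<le> 0} \<le> ann.prob {z \<in> space (env \<Otimes>\<^sub>M unifs). scaled n z \<le> x}"
        using x by (intro ann.finite_measure_mono) auto
      with elim show ?case by simp
    qed
  next
    fix y :: real assume "y < 0"
    then show "eventually (\<lambda>n. y < ann.prob {z \<in> space (env \<Otimes>\<^sub>M unifs). scaled n z \<le> 0}) sequentially"
      by (intro always_eventually allI less_le_trans[OF _ measure_nonneg])
  qed
  then show ?thesis using True by simp
qed (use assms scaled_le_limit_interior in auto)

lemma scaled_interval_limit:
  assumes "0 \<le> a" "a < b" "b \<le> 1"
  shows "(\<lambda>n. ann.prob {z \<in> space (env \<Otimes>\<^sub>M unifs). scaled n z \<in> {a<..<b}})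
    \<longlonglongrightarrow> 2 / pi * arcsin (sqrt b) - 2 / pi * arcsin (sqrt a)"
proof -
  have eq: "ann.prob {z \<in> space (env \<Otimes>\<^sub>M unifs). scaled n z \<in> {a<..<b}}
      = ann.prob {z \<in> space (env \<Otimes>\<^sub>M unifs). scaled n z < b} - ann.prob {z \<in> space (env \<Otimes>\<^sub>M unifs). scaled n z \<le> a}" for n
  proof -
    have set_eq: "{z \<in> space (env \<Otimes>\<^sub>M unifs). scaled n z \<in> {a<..<b}}
        = {z \<in> space (env \<Otimes>\<^sub>M unifs). scaled n z < b} - {z \<in> space (env \<Otimes>\<^sub>M unifs). scaled n z \<le> a}"
      by auto
    show ?thesis
      unfolding set_eq using assms by (intro ann.finite_measure_Diff) auto
  qed
  have lt: "(\<lambda>n. ann.prob {z \<in> space (env \<Otimes>\<^sub>M unifs). scaled n z < b}) \<longlonglongrightarrow> 2 / pi * arcsin (sqrt b)"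
    by (rule scaled_less_limit) (use assms in auto)
  have le: "(\<lambda>n. ann.prob {z \<in> space (env \<Otimes>\<^sub>M unifs). scaled n z \<le> a}) \<longlonglongrightarrow> 2 / pi * arcsin (sqrt a)"
    by (rule scaled_le_limit) (use assms in auto)
  show ?thesis unfolding eq by (rule tendsto_diff[OF lt le])
qed

end

theorem theorem1:
  fixes mu :: "real measure" and a b :: real
  assumes "prob_space mu"
    and "sets mu = sets borel"
    and "measure mu {0..1} = 1"
    and "measure mu {0} = 0" and "measure mu {1} = 0"
    and "\<not> (AE x in mu. x = 1/2)"
    and "integrable mu (\<lambda>x. ln ((1 - x) / x))"
    and "(\<integral>x. ln ((1 - x) / x) \<partial>mu) = 0"
    and "integrable mu (\<lambda>x. (ln ((1 - x) / x))\<^sup>2)"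
    and "0 \<le> a" and "a \<le> b" and "b \<le> 1"
  shows "(\<lambda>n. measure (annealed_space mu)
            {z \<in> space (annealed_space mu).
               real_of_int (dright (fst z) (snd z) n) / real n \<in> {a<..<b}})
         \<longlonglongrightarrow> (LBINT x=a..b. 1 / (pi * sqrt (x * (1 - x))))"
proof -
  interpret environment mu
    using assms(1,2) by (simp add: environment_def environment_axioms_def)
  have elliptic: "AE x in mu. 0 < x \<and> x < 1"
  proof -
    have "AE x in mu. x \<in> {0..1}" using assms(2,3) by (intro AE_prob_1) simp
    moreover have "AE x in mu. x \<notin> {0}" "AE x in mu. x \<notin> {1}"
      using assms(2,4,5) prob_eq_0[of "{0}"] prob_eq_0[of "{1}"] by auto
    ultimately show ?thesis by eventually_elim auto
  qed
  \<comment> \<open>A vanishing second moment would force the environment to be \<open>1/2\<close>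
    almost surely, the excluded case of a flat potential.\<close>
  have "0 < expectation (\<lambda>x. (log_ratio x)\<^sup>2)"
  proof (rule ccontr)
    assume "\<not> 0 < expectation (\<lambda>x. (log_ratio x)\<^sup>2)"
    moreover have "0 \<le> expectation (\<lambda>x. (log_ratio x)\<^sup>2)" by simp
    ultimately have "expectation (\<lambda>x. (log_ratio x)\<^sup>2) = 0" by linarith
    then have "AE x in mu. (log_ratio x)\<^sup>2 = 0"
      using assms(9) by (subst (asm) integral_nonneg_eq_0_iff_AE) (auto simp: log_ratio_def)
    with elliptic have "AE x in mu. x = 1/2"
    proof eventually_elim
      case (elim x)
      then have "(1 - x) / x = 1" by (simp add: log_ratio_def)
      then show ?case using elim by (simp add: field_simps)
    qed
    then show False using assms(6) by simp
  qed
  with elliptic interpret sinai_environment mu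
    using assms(8,9) by unfold_locales (simp_all add: log_ratio_def[abs_def])
  show ?thesis
  proof (cases "a = b")
    case True
    then show ?thesis by (simp add: interval_integral_endpoints_same)
  next
    case False
    then have "a < b" using assms(11) by simp
    from scaled_interval_limit[OF assms(10) this assms(12)] arcsine_integral[OF assms(10) this assms(12)]
    show ?thesis by (simp add: annealed_space_eq scaled_def)
  qed
qed

end
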